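(* Let $\mathbf N=(\{0,1\}^E;\lor,\land,f,g,0,1)$ and $\underset{\sim}{\mathbf N}=(\{0,1\}^E;u_1,u_2,\preccurlyeq,\mathscr T)$ be as defined in the context, and let $\mathscr Y=\mathbb{IS}_{\mathrm c}\mathbb P^+(\underset{\sim}{\mathbf N})$. Let $\omega\in\mathscr D(\mathbf N^\flat,\mathbf 2)\cap\mathscr P(\underset{\sim}{\mathbf N}^\flat,\underset{\sim}{\mathbf 2})$ be given by evaluation at $1$, the identity of the monoid $E$. Let $\mathsf D\colon\mathscr{DO}\to\mathscr Y$ and $\mathsf E\colon\mathscr Y\to\mathscr{DO}$ be the hom-functors $\mathsf D=\mathscr{DO}(-,\mathbf N)$ and $\mathsf E=\mathscr Y(-,\underset{\sim}{\mathbf N})$. Then $\underset{\sim}{\mathbf N}$ strongly dualises $\mathbf N$, that is, $\mathsf D$ and $\mathsf E$ establish a strong duality between $\mathscr{DO}$ and $\mathscr Y$. Moreover $$\mathsf D(\mathbf A)^\flat\cong\mathsf H(\mathbf A^\flat)\ \text{ in }\mathscr P\qquad\text{and}\qquad\mathsf E(\mathbf Y)^\flat\cong\mathsf K(\mathbf Y^\flat)\ \text{ in }\mathscr D,$$ for $\mathbf A\in\mathscr{DO}$ and $\mathbf Y\in\mathscr Y$, where the isomorphisms are set up by $\Phi^{\mathbf A}_\omega\colon x\mapsto\omega\circ x$ for $x\in\mathsf D(\mathbf A)$, and $\Psi^{\mathbf Y}_\omega\colon\alpha\mapsto\omega\circ\alpha$ for $\alpha\in\mathsf E(\mathbf Y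)$.
   Context: **The structures.** $\mathscr{DO}$ is the variety of double Ockham algebras: algebras $(L;\lor,\land,f,g,0,1)$ with $(L;\lor,\land,0,1)$ a bounded distributive lattice and $f,g$ dual endomorphisms of it (interchanging $\lor,\land$ and $0,1$); one has $\mathscr{DO}=\mathbb{ISP}(\mathbf N)$ for the $\mathbf N$ below. $E=\{e_1,e_2\}^*$ is the free monoid on $e_1,e_2$ (words under concatenation, identity $1$ the empty word), $|s|$ the length of $s$. $\mathbf N$ has universe $\{0,1\}^E$, pointwise lattice operations and constants, and $f(a)(s)=1-a(s\cdot e_1)$, $g(a)(s)=1-a(s\cdot e_2)$. In $\underset{\sim}{\mathbf N}$: $\mathscr T$ is the product topology from the discrete topology on $\{0,1\}$; $u_i(a)=a\circ\gamma_i$ with $\gamma_i(s)=e_i\cdot s$ ($i=1,2$); $a\preccurlyeq b$ iff for all $s\in E$, $a(s)\le b(s)$ if $|s|$ is even and $a(s)\ge b(s)$ if $|s|$ is odd. $\omega(a)=a(1)$. **Priestley duality.** $\mathscr D=\mathbb{ISP}(\mathbf 2)$ is the category of bounded distributive lattices and $\mathscr P=\mathbb{IS}_{\mathrm c}\mathbb P^+(\underset{\sim}{\mathbf 2})$ the category of Priestley spaces (continuous order-preserving maps), where $\mathbf 2$ is the bounded lattice on $\{0,1\}$ and $\underset{\sim}{\mathbf 2}$ is $\{0,1\}$ with $0<1$ and the discrete topology. $\mathsf H=\mathscr D(-,\mathbf 2)\colon\mathscr D\to\mathscr P$ and $\mathsf K=\mathscr P(-,\underset{\sim}{\mathbf 2})\colon\mathscr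 P\to\mathscr D$ are the hom-functors of Priestley duality. The symbol $^\flat$ denotes both the forgetful functor $\mathscr{DO}\to\mathscr D$ (forgetting $f,g$) and the forgetful functor $\mathscr Y\to\mathscr P$ (forgetting $u_1,u_2$). **Natural dualities.** $\mathbf N$ is a compact Hausdorff topological algebra under $\mathscr T$, the $u_i$ are continuous endomorphisms of $\mathbf N$ and $\preccurlyeq$ is a closed subalgebra of $\mathbf N^2$. $\mathbb{IS}_{\mathrm c}\mathbb P^+(\underset{\sim}{\mathbf N})$ is the class of isomorphic copies of closed substructures of non-empty powers of $\underset{\sim}{\mathbf N}$ (product topology, operations and relation lifted pointwise), including the empty structure; morphisms are the continuous structure-preserving maps. $\mathsf D(\mathbf A)=\mathscr{DO}(\mathbf A,\mathbf N)$ is regarded as a closed substructure of $\underset{\sim}{\mathbf N}^A$ and $\mathsf E(\mathbf Y)=\mathscr Y(\mathbf Y,\underset{\sim}{\mathbf N})$ as a subalgebra of $\mathbf N^Y$; both functors are contravariant and act on morphisms by precomposition. Let $e_{\mathbf A}\colon\mathbf A\to\mathsf E\mathsf D(\mathbf A)$ and $\varepsilon_{\mathbf Y}\colon\mathbf Y\to\mathsf D\mathsf E(\mathbf Y)$ be the natural evaluation maps. $\underset{\sim}{\mathbf N}$ dualises $\mathbf N$ if every $e_{\mathbf A}$ is an isomorphism; fully dualises if in addition every $\varepsilon_{\mathbf Y}$ is an isomorphism; strongly dualises if it fully dualises and $\underset{\sim}{\mathbf N}$ is injective in $\mathscr Y$ (with respect to embeddings). *)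

theory Defs
  imports "HOL-Analysis.Analysis"
begin

text \<open>
  Algebras and topological structures are records over an arbitrary type; the forgetful functors
  are record truncation. The two-element set \<open>{0,1}\<close> is \<^typ>\<open>bool\<close>, with \<open>0 = False\<close>, \<open>1 = True\<close>.
  Morphisms are functions that are extensional on the universe of their domain, so that hom-sets
  are sets of functions between the universes; composition is \<^const>\<open>compose\<close>.
\<close>

section \<open>Bounded distributive lattices and double Ockham algebras\<close>

record 'a blattice =
  carrier :: "'a set"
  join :: "'a \<Rightarrow> 'a \<Rightarrow> 'a"
  meet :: "'a \<Rightarrow> 'a \<Rightarrow> 'a"
  lzero :: 'a
  lone :: 'a

record 'a ockham2 = "'a blattice" +
  fop :: "'a \<Rightarrow> 'a"
  gop :: "'a \<Rightarrow> 'a"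

definition bounded_distributive_lattice :: "('a, 'r) blattice_scheme \<Rightarrow> bool" where
  "bounded_distributive_lattice L \<longleftrightarrow>
     lzero L \<in> carrier L \<and> lone L \<in> carrier L \<and>
     (\<forall>x\<in>carrier L. \<forall>y\<in>carrier L. join L x y \<in> carrier L \<and> meet L x y \<in> carrier L) \<and>
     (\<forall>x\<in>carrier L. \<forall>y\<in>carrier L. \<forall>z\<in>carrier L.
        join L (join L x y) z = join L x (join L y z) \<and>
        meet L (meet L x y) z = meet L x (meet L y z) \<and>
        meet L x (join L y z) = join L (meet L x y) (meet L x z)) \<and>
     (\<forall>x\<in>carrier L. \<forall>y\<in>carrier L.
        join L x y = join L y x \<and> meet L x y = meet L y x \<and>
        join L x (meet L x y) = x \<and> meet L x (join L x y) = x) \<and>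
     (\<forall>x\<in>carrier L. join L (lzero L) x = x \<and> meet L (lone L) x = x)"

definition dual_endomorphism :: "('a, 'r) blattice_scheme \<Rightarrow> ('a \<Rightarrow> 'a) \<Rightarrow> bool" where
  "dual_endomorphism L h \<longleftrightarrow>
     (\<forall>x\<in>carrier L. h x \<in> carrier L) \<and>
     (\<forall>x\<in>carrier L. \<forall>y\<in>carrier L.
        h (join L x y) = meet L (h x) (h y) \<and> h (meet L x y) = join L (h x) (h y)) \<and>
     h (lzero L) = lone L \<and> h (lone L) = lzero L"

definition double_Ockham :: "'a ockham2 \<Rightarrow> bool" where
  "double_Ockham A \<longleftrightarrow>
     bounded_distributive_lattice A \<and>
     dual_endomorphism A (fop A) \<and> dual_endomorphism A (gop A)"

definition lat_hom ::
  "('a, 'r) blattice_scheme \<Rightarrow> ('b, 's) blattice_scheme \<Rightarrow> ('a \<Rightarrow> 'b) set" where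
  "lat_hom L M = {h \<in> carrier L \<rightarrow>\<^sub>E carrier M.
     (\<forall>x\<in>carrier L. \<forall>y\<in>carrier L.
        h (join L x y) = join M (h x) (h y) \<and> h (meet L x y) = meet M (h x) (h y)) \<and>
     h (lzero L) = lzero M \<and> h (lone L) = lone M}"

definition ock_hom :: "'a ockham2 \<Rightarrow> 'b ockham2 \<Rightarrow> ('a \<Rightarrow> 'b) set" where
  "ock_hom A B = {h \<in> lat_hom A B.
     \<forall>x\<in>carrier A. h (fop A x) = fop B (h x) \<and> h (gop A x) = gop B (h x)}"

definition lat_iso ::
  "('a, 'r) blattice_scheme \<Rightarrow> ('b, 's) blattice_scheme \<Rightarrow> ('a \<Rightarrow> 'b) \<Rightarrow> bool" where
  "lat_iso L M h \<longleftrightarrow> h \<in> lat_hom L M \<and>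
     (\<exists>k \<in> lat_hom M L. (\<forall>x\<in>carrier L. k (h x) = x) \<and> (\<forall>y\<in>carrier M. h (k y) = y))"

definition ock_iso :: "'a ockham2 \<Rightarrow> 'b ockham2 \<Rightarrow> ('a \<Rightarrow> 'b) \<Rightarrow> bool" where
  "ock_iso A B h \<longleftrightarrow> h \<in> ock_hom A B \<and>
     (\<exists>k \<in> ock_hom B A. (\<forall>x\<in>carrier A. k (h x) = x) \<and> (\<forall>y\<in>carrier B. h (k y) = y))"

abbreviation lat_flat :: "'a ockham2 \<Rightarrow> 'a blattice" where
  "lat_flat \<equiv> blattice.truncate"

definition lat_power :: "'i set \<Rightarrow> 'm blattice \<Rightarrow> ('i \<Rightarrow> 'm) blattice" where
  "lat_power I M = \<lparr>
     carrier = I \<rightarrow>\<^sub>E carrier M,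
     join = (\<lambda>x y. \<lambda>i\<in>I. join M (x i) (y i)),
     meet = (\<lambda>x y. \<lambda>i\<in>I. meet M (x i) (y i)),
     lzero = (\<lambda>i\<in>I. lzero M),
     lone = (\<lambda>i\<in>I. lone M)\<rparr>"

definition ock_power :: "'i set \<Rightarrow> 'm ockham2 \<Rightarrow> ('i \<Rightarrow> 'm) ockham2" where
  "ock_power I M = blattice.extend (lat_power I (lat_flat M))
     (ockham2.fields (\<lambda>x. \<lambda>i\<in>I. fop M (x i)) (\<lambda>x. \<lambda>i\<in>I. gop M (x i)))"

section \<open>Topological structures\<close>

text \<open>The universe of a structure is the \<^const>\<open>topspace\<close> of its topology. The relation and the
  operations are only relevant on that set.\<close>

record 'a ordspace =
  topo :: "'a topology"
  leq :: "'a \<Rightarrow> 'a \<Rightarrow> bool"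

record 'a uspace = "'a ordspace" +
  u1 :: "'a \<Rightarrow> 'a"
  u2 :: "'a \<Rightarrow> 'a"

abbreviation pts :: "('a, 'r) ordspace_scheme \<Rightarrow> 'a set" where
  "pts X \<equiv> topspace (topo X)"

definition ord_mor ::
  "('a, 'r) ordspace_scheme \<Rightarrow> ('b, 's) ordspace_scheme \<Rightarrow> ('a \<Rightarrow> 'b) set" where
  "ord_mor X Y = {h \<in> pts X \<rightarrow>\<^sub>E pts Y. continuous_map (topo X) (topo Y) h \<and>
     (\<forall>x\<in>pts X. \<forall>y\<in>pts X. leq X x y \<longrightarrow> leq Y (h x) (h y))}"

definition u_mor :: "'a uspace \<Rightarrow> 'b uspace \<Rightarrow> ('a \<Rightarrow> 'b) set" where
  "u_mor X Y = {h \<in> ord_mor X Y.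
     \<forall>x\<in>pts X. h (u1 X x) = u1 Y (h x) \<and> h (u2 X x) = u2 Y (h x)}"

definition ord_iso ::
  "('a, 'r) ordspace_scheme \<Rightarrow> ('b, 's) ordspace_scheme \<Rightarrow> ('a \<Rightarrow> 'b) \<Rightarrow> bool" where
  "ord_iso X Y h \<longleftrightarrow> h \<in> ord_mor X Y \<and>
     (\<exists>k \<in> ord_mor Y X. (\<forall>x\<in>pts X. k (h x) = x) \<and> (\<forall>y\<in>pts Y. h (k y) = y))"

definition u_iso :: "'a uspace \<Rightarrow> 'b uspace \<Rightarrow> ('a \<Rightarrow> 'b) \<Rightarrow> bool" where
  "u_iso X Y h \<longleftrightarrow> h \<in> u_mor X Y \<and>
     (\<exists>k \<in> u_mor Y X. (\<forall>x\<in>pts X. k (h x) = x) \<and> (\<forall>y\<in>pts Y. h (k y) = y))"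

abbreviation ord_flat :: "'a uspace \<Rightarrow> 'a ordspace" where
  "ord_flat \<equiv> ordspace.truncate"

definition ord_power :: "'i set \<Rightarrow> 'm ordspace \<Rightarrow> ('i \<Rightarrow> 'm) ordspace" where
  "ord_power I M = \<lparr>
     topo = product_topology (\<lambda>_. topo M) I,
     leq = (\<lambda>x y. \<forall>i\<in>I. leq M (x i) (y i))\<rparr>"

definition u_power :: "'i set \<Rightarrow> 'm uspace \<Rightarrow> ('i \<Rightarrow> 'm) uspace" where
  "u_power I M = ordspace.extend (ord_power I (ord_flat M))
     (uspace.fields (\<lambda>x. \<lambda>i\<in>I. u1 M (x i)) (\<lambda>x. \<lambda>i\<in>I. u2 M (x i)))"

definition on_subset :: "('a, 'r) ordspace_scheme \<Rightarrow> 'a set \<Rightarrow> ('a, 'r) ordspace_scheme" where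
  "on_subset X S = X\<lparr>topo := subtopology (topo X) S\<rparr>"

definition u_closed :: "'a uspace \<Rightarrow> 'a set \<Rightarrow> bool" where
  "u_closed X S \<longleftrightarrow> (\<forall>x\<in>S. u1 X x \<in> S \<and> u2 X x \<in> S)"

definition closed_substructure :: "'a uspace \<Rightarrow> 'a set \<Rightarrow> bool" where
  "closed_substructure X S \<longleftrightarrow> closedin (topo X) S \<and> u_closed X S"

definition u_embedding :: "'a uspace \<Rightarrow> 'b uspace \<Rightarrow> ('a \<Rightarrow> 'b) \<Rightarrow> bool" where
  "u_embedding X Y h \<longleftrightarrow>
     closed_substructure Y (h ` pts X) \<and> u_iso X (on_subset Y (h ` pts X)) h"

section \<open>The algebra and its alter ego\<close>

datatype letter = e1 | e2

text \<open>The free monoid on \<^const>\<open>e1\<close>, \<^const>\<open>e2\<close>; its identity is the empty list.\<close>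

type_synonym word = "letter list"

type_synonym N = "word \<Rightarrow> bool"

definition N_alg :: "N ockham2" where
  "N_alg = \<lparr>
     carrier = UNIV,
     join = (\<lambda>a b s. a s \<or> b s),
     meet = (\<lambda>a b s. a s \<and> b s),
     lzero = (\<lambda>s. False),
     lone = (\<lambda>s. True),
     fop = (\<lambda>a s. \<not> a (s @ [e1])),
     gop = (\<lambda>a s. \<not> a (s @ [e2]))\<rparr>"

definition N_str :: "N uspace" where
  "N_str = \<lparr>
     topo = product_topology (\<lambda>_. discrete_topology UNIV) UNIV,
     leq = (\<lambda>a b. \<forall>s. (even (length s) \<longrightarrow> a s \<le> b s) \<and> (odd (length s) \<longrightarrow> b s \<le> a s)),
     u1 = (\<lambda>a s. a (e1 # s)),
     u2 = (\<lambda>a s. a (e2 # s))\<rparr>"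

definition omega :: "N \<Rightarrow> bool" where
  "omega a = a []"

text \<open>
  Membership in \<open>\<Y> = IS\<^sub>cP\<^sup>+(N_str)\<close>. HOL has no quantification over types inside a formula, so the
  type from which the index set of the power is taken is an explicit parameter. The subset \<open>S\<close> may
  be empty, so the empty structure belongs to the class.
\<close>

definition in_Y :: "'i itself \<Rightarrow> 'y uspace \<Rightarrow> bool" where
  "in_Y _ Y \<longleftrightarrow> u_closed Y (pts Y) \<and>
     (\<exists>(I :: 'i set) S h. I \<noteq> {} \<and> closed_substructure (u_power I N_str) S \<and>
        u_iso Y (on_subset (u_power I N_str) S) h)"

section \<open>Priestley duality\<close>

definition two_lat :: "bool blattice" where
  "two_lat = \<lparr>carrier = UNIV, join = (\<or>), meet = (\<and>), lzero = False, lone = True\<rparr>"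

definition two_space :: "bool ordspace" where
  "two_space = \<lparr>topo = discrete_topology UNIV, leq = (\<le>)\<rparr>"

text \<open>Priestley spaces, as \<open>IS\<^sub>cP\<^sup>+(two_space)\<close>; the index type is a parameter as before.\<close>

definition in_P :: "'i itself \<Rightarrow> 'x ordspace \<Rightarrow> bool" where
  "in_P _ X \<longleftrightarrow>
     (\<exists>(I :: 'i set) S h. I \<noteq> {} \<and> closedin (topo (ord_power I two_space)) S \<and>
        ord_iso X (on_subset (ord_power I two_space) S) h)"

definition H_obj :: "'a blattice \<Rightarrow> ('a \<Rightarrow> bool) ordspace" where
  "H_obj L = on_subset (ord_power (carrier L) two_space) (lat_hom L two_lat)"

definition K_obj :: "'x ordspace \<Rightarrow> ('x \<Rightarrow> bool) blattice" where
  "K_obj X = (lat_power (pts X) two_lat)\<lparr>carrier := ord_mor X two_space\<rparr>"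

section \<open>The hom-functors and the duality\<close>

definition D_obj :: "'a ockham2 \<Rightarrow> ('a \<Rightarrow> N) uspace" where
  "D_obj A = on_subset (u_power (carrier A) N_str) (ock_hom A N_alg)"

definition E_obj :: "'y uspace \<Rightarrow> ('y \<Rightarrow> N) ockham2" where
  "E_obj Y = (ock_power (pts Y) N_alg)\<lparr>carrier := u_mor Y N_str\<rparr>"

definition D_mor :: "'a ockham2 \<Rightarrow> 'b ockham2 \<Rightarrow> ('a \<Rightarrow> 'b) \<Rightarrow> (('b \<Rightarrow> N) \<Rightarrow> ('a \<Rightarrow> N))" where
  "D_mor A B h = (\<lambda>x\<in>pts (D_obj B). compose (carrier A) x h)"

definition E_mor :: "'y uspace \<Rightarrow> 'z uspace \<Rightarrow> ('y \<Rightarrow> 'z) \<Rightarrow> (('z \<Rightarrow> N) \<Rightarrow> ('y \<Rightarrow> N))" where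
  "E_mor Y Z h = (\<lambda>\<alpha>\<in>carrier (E_obj Z). compose (pts Y) \<alpha> h)"

definition eval_alg :: "'a ockham2 \<Rightarrow> 'a \<Rightarrow> (('a \<Rightarrow> N) \<Rightarrow> N)" where
  "eval_alg A = (\<lambda>a\<in>carrier A. \<lambda>x\<in>pts (D_obj A). x a)"

definition eval_str :: "'y uspace \<Rightarrow> 'y \<Rightarrow> (('y \<Rightarrow> N) \<Rightarrow> N)" where
  "eval_str Y = (\<lambda>y\<in>pts Y. \<lambda>\<alpha>\<in>carrier (E_obj Y). \<alpha> y)"

text \<open>
  The types over which the algebras and structures range are parameters of the following notions;
  a theorem asserting them for type variables asserts them for all types.
\<close>

definition dualises :: "'a itself \<Rightarrow> bool" where
  "dualises _ \<longleftrightarrow>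
     (\<forall>A :: 'a ockham2. double_Ockham A \<longrightarrow> ock_iso A (E_obj (D_obj A)) (eval_alg A))"

definition fully_dualises :: "'a itself \<Rightarrow> 'i itself \<Rightarrow> 'y itself \<Rightarrow> bool" where
  "fully_dualises ta ti _ \<longleftrightarrow> dualises ta \<and>
     (\<forall>Y :: 'y uspace. in_Y ti Y \<longrightarrow> u_iso Y (D_obj (E_obj Y)) (eval_str Y))"

definition N_str_injective ::
  "'i itself \<Rightarrow> 'y itself \<Rightarrow> 'j itself \<Rightarrow> 'z itself \<Rightarrow> bool" where
  "N_str_injective ti _ tj _ \<longleftrightarrow>
     (\<forall>(Y :: 'y uspace) (Z :: 'z uspace) h \<alpha>.
        in_Y ti Y \<and> in_Y tj Z \<and> u_embedding Y Z h \<and> \<alpha> \<in> u_mor Y N_str \<longrightarrow>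
        (\<exists>\<beta>\<in>u_mor Z N_str. compose (pts Y) \<beta> h = \<alpha>))"

definition strongly_dualises ::
  "'a itself \<Rightarrow> 'i itself \<Rightarrow> 'y itself \<Rightarrow> 'j itself \<Rightarrow> 'z itself \<Rightarrow> bool" where
  "strongly_dualises ta ti ty tj tz \<longleftrightarrow>
     fully_dualises ta ti ty \<and> N_str_injective ti ty tj tz"

definition Phi :: "'a ockham2 \<Rightarrow> ('a \<Rightarrow> N) \<Rightarrow> ('a \<Rightarrow> bool)" where
  "Phi A = (\<lambda>x\<in>pts (D_obj A). compose (carrier A) omega x)"

definition Psi :: "'y uspace \<Rightarrow> ('y \<Rightarrow> N) \<Rightarrow> ('y \<Rightarrow> bool)" where
  "Psi Y = (\<lambda>\<alpha>\<in>carrier (E_obj Y). compose (pts Y) omega \<alpha>)"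

end

theory Submission
  imports Defs
begin

text \<open>
  A point of \<open>N\<close> is a function on words, and both the algebra operations
  and the maps \<open>u\<^sub>1\<close>, \<open>u\<^sub>2\<close> shift its argument, from the right and from the left respectively.
  Hence a homomorphism \<open>x\<close> of double Ockham algebras into \<open>N\<close> can be recovered from its value at the
  empty word: \<open>x a s\<close> is, up to a sign given by the parity of \<open>s\<close>, the value of \<open>\<omega> \<circ> x\<close> at the element
  obtained from \<open>a\<close> by applying the operations named in \<open>s\<close>. Conversely every lattice homomorphism
  into \<open>2\<close> arises in this way, because a word of operations is an endomorphism or a dual endomorphism
  according to that parity, and the sign turns both into the same thing. On the other side a morphism
  into the alter ego is recovered in the same manner from its composite with \<open>\<omega>\<close>, and every
  continuous order-preserving map into \<open>2\<close> arises. So \<open>\<Phi>\<close> and \<open>\<Psi>\<close> are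
  bijections (\<open>ord_iso_Phi\<close>, \<open>lat_iso_Psi\<close>), and everything reduces to Priestley duality.

  The structures in the class generated by the alter ego enter only through a few properties,
  collected in the locale \<open>ockham_space\<close>: they are compact, \<open>u\<^sub>1\<close> and \<open>u\<^sub>2\<close> are continuous and
  order-reversing, and points that are not related by the order are separated by a morphism into
  \<open>2\<close>. What remains are three compactness arguments and the existence of prime filters:
  \<^item> an algebra embeds into its bidual by the prime filter theorem, and it fills the bidual because
    the clopen sets coming from its elements form a ring that separates points as far as the order
    does, hence also separates a clopen up-set from its complement (\<open>eval_alg_surj\<close>);
  \<^item> a structure embeds into its bidual by the separation axiom, and it fills the bidual because
    otherwise the clopen sets that describe a point of the bidual would be a downward directed
    family of nonempty closed sets without a common point (\<open>eval_str_surj\<close>);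
  \<^item> the alter ego is injective because \<open>2\<close> is injective among Priestley spaces: the ring
    of clopen up-sets of the larger structure separates the two closed parts into which a
    morphism to \<open>2\<close> cuts the smaller one (\<open>u_mor_extends\<close>).
\<close>

section \<open>Compactness\<close>

text \<open>Directedness turns finite intersections into single members, so the family has the finite
  intersection property.\<close>

lemma compact_space_directed_family:
  assumes "compact_space X" "\<C> \<noteq> {}"
    and closed: "\<And>C. C \<in> \<C> \<Longrightarrow> closedin X C \<and> C \<noteq> {}"
    and dir: "\<And>C D. C \<in> \<C> \<Longrightarrow> D \<in> \<C> \<Longrightarrow> \<exists>B\<in>\<C>. B \<subseteq> C \<inter> D"
  shows "\<Inter>\<C> \<noteq> {}"
proof -
  have lower: "\<exists>B\<in>\<C>. B \<subseteq> \<Inter>\<F>" if "finite \<F>" "\<F> \<subseteq> \<C>" for \<F>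
    using that
  proof (induction \<F>)
    case empty
    then show ?case using \<open>\<C> \<noteq> {}\<close> by auto
  next
    case (insert C \<F>)
    then obtain B where "B \<in> \<C>" "B \<subseteq> \<Inter>\<F>" "C \<in> \<C>" by auto
    with dir[of C B] show ?case by auto
  qed
  have fip: "\<Inter>\<F> \<noteq> {}" if \<F>: "finite \<F> \<and> \<F> \<subseteq> \<C>" for \<F>
  proof -
    obtain B where "B \<in> \<C>" "B \<subseteq> \<Inter>\<F>" using lower[of \<F>] \<F> by auto
    with closed[of B] show ?thesis by fastforce
  qed
  show ?thesis
    by (rule assms(1)[unfolded compact_space_fip, rule_format]) (use closed fip in auto)
qed

text \<open>Two applications of compactness: for a fixed point of \<open>C\<close>, the members of the ring around it cannot
  all meet \<open>D\<close>; then the members of the ring that miss \<open>D\<close> are directed upwards, so a single one of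
  them covers \<open>C\<close>. In Priestley duality this is the passage from separation of points to separation
  of closed sets.\<close>

lemma ring_of_clopens_separates_closed_sets:
  assumes cpt: "compact_space X"
    and clopen: "\<And>W. W \<in> \<W> \<Longrightarrow> openin X W \<and> closedin X W"
    and bounds: "{} \<in> \<W>" "topspace X \<in> \<W>"
    and ring: "\<And>V W. V \<in> \<W> \<Longrightarrow> W \<in> \<W> \<Longrightarrow> V \<inter> W \<in> \<W> \<and> V \<union> W \<in> \<W>"
    and C: "closedin X C" and D: "closedin X D"
    and sep: "\<And>x y. x \<in> C \<Longrightarrow> y \<in> D \<Longrightarrow> \<exists>W\<in>\<W>. x \<in> W \<and> y \<notin> W"
  shows "\<exists>W\<in>\<W>. C \<subseteq> W \<and> W \<inter> D = {}"
proof -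
  have point: "\<exists>W\<in>\<W>. x \<in> W \<and> W \<inter> D = {}" if "x \<in> C" for x
  proof (rule ccontr)
    assume neg: "\<not> ?thesis"
    let ?\<C> = "(\<lambda>W. W \<inter> D) ` {W \<in> \<W>. x \<in> W}"
    have "\<Inter>?\<C> \<noteq> {}"
    proof (rule compact_space_directed_family[OF cpt])
      have "x \<in> topspace X" using \<open>x \<in> C\<close> C closedin_subset by blast
      then show "?\<C> \<noteq> {}" using bounds(2) by blast
      show "closedin X B \<and> B \<noteq> {}" if "B \<in> ?\<C>" for B
        using that neg clopen D by (auto intro: closedin_Int)
      show "\<exists>A\<in>?\<C>. A \<subseteq> B \<inter> B'" if BB: "B \<in> ?\<C>" "B' \<in> ?\<C>" for B B'
      proof -
        from BB obtain V V' where V: "V \<in> \<W>" "x \<in> V" "B = V \<inter> D"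
          and V': "V' \<in> \<W>" "x \<in> V'" "B' = V' \<inter> D" by blast
        then have "V \<inter> V' \<in> {W \<in> \<W>. x \<in> W}" using ring by simp
        moreover have "(V \<inter> V') \<inter> D \<subseteq> B \<inter> B'" using V(3) V'(3) by auto
        ultimately show ?thesis by (rule_tac bexI[OF _ imageI])
      qed
    qed
    then obtain y where y0: "y \<in> \<Inter>?\<C>" by (meson ex_in_conv)
    then have y: "y \<in> W \<inter> D" if "W \<in> \<W>" "x \<in> W" for W
      using InterD[OF y0, of "W \<inter> D"] that by blast
    have "y \<in> D"
      using y[OF bounds(2)] \<open>x \<in> C\<close> C closedin_subset by blast
    with sep[OF \<open>x \<in> C\<close>] y show False by blast
  qed
  show ?thesis
  proof (rule ccontr)
    assume neg: "\<not> ?thesis"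
    let ?\<C> = "(\<lambda>W. C - W) ` {W \<in> \<W>. W \<inter> D = {}}"
    have "\<Inter>?\<C> \<noteq> {}"
    proof (rule compact_space_directed_family[OF cpt])
      show "?\<C> \<noteq> {}" using bounds(1) by blast
      show "closedin X B \<and> B \<noteq> {}" if "B \<in> ?\<C>" for B
        using that neg clopen C by (auto intro: closedin_diff)
      show "\<exists>A\<in>?\<C>. A \<subseteq> B \<inter> B'" if BB: "B \<in> ?\<C>" "B' \<in> ?\<C>" for B B'
      proof -
        from BB obtain V V' where V: "V \<in> \<W>" "V \<inter> D = {}" "B = C - V"
          and V': "V' \<in> \<W>" "V' \<inter> D = {}" "B' = C - V'" by blast
        then have "V \<union> V' \<in> {W \<in> \<W>. W \<inter> D = {}}" using ring by auto
        moreover have "C - (V \<union> V') \<subseteq> B \<inter> B'" using V(3) V'(3) by auto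
        ultimately show ?thesis by (rule_tac bexI[OF _ imageI])
      qed
    qed
    then obtain x where x0: "x \<in> \<Inter>?\<C>" by (meson ex_in_conv)
    then have x: "x \<in> C - W" if "W \<in> \<W>" "W \<inter> D = {}" for W
      using InterD[OF x0, of "C - W"] that by blast
    have "x \<in> C" using x[OF bounds(1)] by simp
    then obtain W where W: "W \<in> \<W>" "x \<in> W" "W \<inter> D = {}"
      using point by meson
    then show False using x[OF W(1) W(3)] by simp
  qed
qed

abbreviation two_top :: "bool topology" where
  "two_top \<equiv> discrete_topology UNIV"

lemma continuous_map_two_top_iff:
  "continuous_map X two_top f \<longleftrightarrow>
     openin X {x \<in> topspace X. f x} \<and> openin X {x \<in> topspace X. \<not> f x}"
proof
  assume f: "continuous_map X two_top f"
  show "openin X {x \<in> topspace X. f x} \<and> openin X {x \<in> topspace X. \<not> f x}"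
    using openin_continuous_map_preimage[OF f, of "{True}"]
      openin_continuous_map_preimage[OF f, of "{False}"] by simp
next
  assume o: "openin X {x \<in> topspace X. f x} \<and> openin X {x \<in> topspace X. \<not> f x}"
  have "openin X {x \<in> topspace X. f x \<in> U}" for U
  proof -
    have "{x \<in> topspace X. f x \<in> U} =
        (if True \<in> U then {x \<in> topspace X. f x} else {}) \<union>
        (if False \<in> U then {x \<in> topspace X. \<not> f x} else {})"
      by (auto split: if_splits) (metis (full_types))+
    also have "openin X \<dots>" using o by (intro openin_Un) auto
    finally show ?thesis .
  qed
  then show "continuous_map X two_top f"
    by (simp add: continuous_map_def)
qed

lemma clopen_preimage_two_top:
  assumes "continuous_map X two_top f"
  shows "openin X {x \<in> topspace X. f x}" "closedin X {x \<in> topspace X. f x}"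
    and "closedin X {x \<in> topspace X. \<not> f x}"
  using assms closedin_continuous_map_preimage[OF assms, of "{True}"]
    closedin_continuous_map_preimage[OF assms, of "{False}"]
  by (auto simp: continuous_map_two_top_iff)

lemma continuous_map_two_top_Not:
  "continuous_map X two_top f \<Longrightarrow> continuous_map X two_top (\<lambda>x. \<not> f x)"
  by (simp add: continuous_map_two_top_iff)

lemma continuous_map_two_top_conj:
  assumes "continuous_map X two_top f" "continuous_map X two_top g"
  shows "continuous_map X two_top (\<lambda>x. f x \<and> g x)"
proof -
  have conj: "{x \<in> topspace X. f x \<and> g x} = {x \<in> topspace X. f x} \<inter> {x \<in> topspace X. g x}"
    by auto
  have disj: "{x \<in> topspace X. \<not> (f x \<and> g x)} =
      {x \<in> topspace X. \<not> f x} \<union> {x \<in> topspace X. \<not> g x}"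
    by auto
  have "openin X {x \<in> topspace X. f x}" "openin X {x \<in> topspace X. \<not> f x}"
    "openin X {x \<in> topspace X. g x}" "openin X {x \<in> topspace X. \<not> g x}"
    using assms by (simp_all only: continuous_map_two_top_iff)
  then show ?thesis
    unfolding continuous_map_two_top_iff conj disj by (simp only: openin_Int openin_Un)
qed

lemma continuous_map_two_top_disj:
  assumes "continuous_map X two_top f" "continuous_map X two_top g"
  shows "continuous_map X two_top (\<lambda>x. f x \<or> g x)"
proof -
  have "continuous_map X two_top (\<lambda>x. \<not> (\<not> f x \<and> \<not> g x))"
    using assms by (intro continuous_map_two_top_Not continuous_map_two_top_conj)
  then show ?thesis by simp
qed

lemma continuous_map_two_top_neq_const:
  "continuous_map X two_top f \<Longrightarrow> continuous_map X two_top (\<lambda>x. f x \<noteq> c)"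
  using continuous_map_two_top_Not[of X f] by (cases c) simp_all

lemmas continuous_map_two_top_intros =
  continuous_map_two_top_Not continuous_map_two_top_conj continuous_map_two_top_disj
  continuous_map_two_top_neq_const

section \<open>Separation of elements of a distributive lattice\<close>

locale bd_lattice =
  fixes L :: "('a, 'r) blattice_scheme"
  assumes bdl: "bounded_distributive_lattice L"
begin

lemma closed [simp]:
  "lzero L \<in> carrier L" "lone L \<in> carrier L"
  "x \<in> carrier L \<Longrightarrow> y \<in> carrier L \<Longrightarrow> join L x y \<in> carrier L"
  "x \<in> carrier L \<Longrightarrow> y \<in> carrier L \<Longrightarrow> meet L x y \<in> carrier L"
  using bdl unfolding bounded_distributive_lattice_def by auto

lemma laws:
  assumes "x \<in> carrier L" "y \<in> carrier L"
  shows "join L x y = join L y x" "meet L x y = meet L y x"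
    and "join L x (meet L x y) = x" "meet L x (join L x y) = x"
  using bdl assms unfolding bounded_distributive_lattice_def by (elim conjE; blast)+

lemma unit_laws:
  assumes "x \<in> carrier L"
  shows "join L (lzero L) x = x" "meet L (lone L) x = x"
  using bdl assms unfolding bounded_distributive_lattice_def by (elim conjE; blast)+

lemma assoc_distrib:
  assumes "x \<in> carrier L" "y \<in> carrier L" "z \<in> carrier L"
  shows "join L (join L x y) z = join L x (join L y z)"
    and "meet L (meet L x y) z = meet L x (meet L y z)"
    and "meet L x (join L y z) = join L (meet L x y) (meet L x z)"
  using bdl assms unfolding bounded_distributive_lattice_def by (elim conjE; blast)+

definition le :: "'a \<Rightarrow> 'a \<Rightarrow> bool" where
  "le x y \<longleftrightarrow> meet L x y = x"

lemma meet_idem: "x \<in> carrier L \<Longrightarrow> meet L x x = x"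
  by (metis laws(3,4) closed(4))

lemma le_refl: "x \<in> carrier L \<Longrightarrow> le x x"
  by (simp add: le_def meet_idem)

lemma le_trans:
  "x \<in> carrier L \<Longrightarrow> y \<in> carrier L \<Longrightarrow> z \<in> carrier L \<Longrightarrow> le x y \<Longrightarrow> le y z \<Longrightarrow> le x z"
  unfolding le_def by (metis assoc_distrib(2))

lemma le_antisym: "x \<in> carrier L \<Longrightarrow> y \<in> carrier L \<Longrightarrow> le x y \<Longrightarrow> le y x \<Longrightarrow> x = y"
  unfolding le_def using laws(2) by metis

lemma meet_le:
  assumes "x \<in> carrier L" "y \<in> carrier L"
  shows "le (meet L x y) x" "le (meet L x y) y"
  unfolding le_def using assms by (metis assoc_distrib(2) laws(2) meet_idem closed(4))+

lemma meet_greatest: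
  "x \<in> carrier L \<Longrightarrow> y \<in> carrier L \<Longrightarrow> z \<in> carrier L \<Longrightarrow> le z x \<Longrightarrow> le z y \<Longrightarrow> le z (meet L x y)"
  unfolding le_def by (metis assoc_distrib(2))

lemma meet_mono:
  assumes "x \<in> carrier L" "y \<in> carrier L" "x' \<in> carrier L" "y' \<in> carrier L" "le x x'" "le y y'"
  shows "le (meet L x y) (meet L x' y')"
proof (rule meet_greatest)
  show "le (meet L x y) x'"
    using assms by (intro le_trans[OF _ _ _ meet_le(1)[OF assms(1,2)]]) auto
  show "le (meet L x y) y'"
    using assms by (intro le_trans[OF _ _ _ meet_le(2)[OF assms(1,2)]]) auto
qed (use assms in auto)

lemma le_join:
  assumes "x \<in> carrier L" "y \<in> carrier L"
  shows "le x (join L x y)" "le y (join L x y)"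
  unfolding le_def using assms by (metis laws(1,4))+

lemma join_least:
  "x \<in> carrier L \<Longrightarrow> y \<in> carrier L \<Longrightarrow> z \<in> carrier L \<Longrightarrow> le x z \<Longrightarrow> le y z \<Longrightarrow> le (join L x y) z"
  unfolding le_def by (metis assoc_distrib(3) laws(2) closed(3))

lemma zero_le: "x \<in> carrier L \<Longrightarrow> le (lzero L) x"
  by (metis unit_laws(1) le_join(1) closed(1))

lemma le_one: "x \<in> carrier L \<Longrightarrow> le x (lone L)"
  by (metis le_def laws(2) unit_laws(2) closed(2))

definition filter_on :: "'a set \<Rightarrow> bool" where
  "filter_on F \<longleftrightarrow> F \<subseteq> carrier L \<and> lone L \<in> F \<and> (\<forall>x\<in>F. \<forall>y\<in>F. meet L x y \<in> F) \<and>
     (\<forall>x\<in>F. \<forall>y\<in>carrier L. le x y \<longrightarrow> y \<in> F)"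

text \<open>A filter that is maximal among those containing \<open>a\<close> and missing \<open>b\<close> is prime: if it contained
  \<open>x \<or> y\<close> but neither \<open>x\<close> nor \<open>y\<close>, then both enlargements would reach \<open>b\<close>, and distributivity would
  put \<open>b\<close> into the filter itself.\<close>

lemma prime_filter_separation:
  assumes a: "a \<in> carrier L" and b: "b \<in> carrier L" and ab: "\<not> le a b"
  shows "\<exists>F. filter_on F \<and> a \<in> F \<and> b \<notin> F \<and>
    (\<forall>x\<in>carrier L. \<forall>y\<in>carrier L. join L x y \<in> F \<longrightarrow> x \<in> F \<or> y \<in> F)"
proof -
  define \<A> where "\<A> = {F. filter_on F \<and> a \<in> F \<and> b \<notin> F}"
  have "{x \<in> carrier L. le a x} \<in> \<A>"
    unfolding \<A>_def filter_on_def using a b ab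
    by (auto simp: le_one le_refl intro: meet_greatest le_trans)
  then have "\<A> \<noteq> {}" by blast
  moreover have "\<Union>\<C> \<in> \<A>" if "\<C> \<noteq> {}" "subset.chain \<A> \<C>" for \<C>
  proof -
    have sub: "\<C> \<subseteq> \<A>" and lin: "\<And>F G. F \<in> \<C> \<Longrightarrow> G \<in> \<C> \<Longrightarrow> F \<subseteq> G \<or> G \<subseteq> F"
      using that by (auto simp: subset_chain_def)
    have meet: "meet L x y \<in> \<Union>\<C>" if xy: "x \<in> \<Union>\<C>" "y \<in> \<Union>\<C>" for x y
    proof -
      obtain F G where FG: "F \<in> \<C>" "x \<in> F" "G \<in> \<C>" "y \<in> G" using xy by blast
      with lin[of F G] obtain K where "K \<in> \<C>" "x \<in> K" "y \<in> K" by blast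
      with sub show ?thesis unfolding \<A>_def filter_on_def by blast
    qed
    show ?thesis
      unfolding \<A>_def filter_on_def mem_Collect_eq
    proof (intro conjI ballI)
      show "meet L x y \<in> \<Union>\<C>" if "x \<in> \<Union>\<C>" "y \<in> \<Union>\<C>" for x y using meet that .
    qed (use sub \<open>\<C> \<noteq> {}\<close> in \<open>unfold \<A>_def filter_on_def, blast+\<close>)
  qed
  ultimately obtain F where F: "F \<in> \<A>" and max: "\<And>G. G \<in> \<A> \<Longrightarrow> F \<subseteq> G \<Longrightarrow> G = F"
    using subset_Zorn_nonempty[of \<A>] by metis
  have fil: "filter_on F" "a \<in> F" "b \<notin> F" using F by (auto simp: \<A>_def)
  have FL: "F \<subseteq> carrier L" and one: "lone L \<in> F"
    and meetF: "\<And>x y. x \<in> F \<Longrightarrow> y \<in> F \<Longrightarrow> meet L x y \<in> F"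
    and upF: "\<And>x y. x \<in> F \<Longrightarrow> y \<in> carrier L \<Longrightarrow> le x y \<Longrightarrow> y \<in> F"
    using fil(1) by (auto simp: filter_on_def)
  \<comment> \<open>by maximality, adding any further element forces \<open>b\<close> into the filter\<close>
  have ext: "\<exists>p\<in>F. le (meet L p x) b" if x: "x \<in> carrier L" "x \<notin> F" for x
  proof (rule ccontr)
    assume neg: "\<not> ?thesis"
    \<comment> \<open>the filter generated by \<open>F\<close> and \<open>x\<close>\<close>
    define G where "G = {z \<in> carrier L. \<exists>p\<in>F. le (meet L p x) z}"
    have "filter_on G"
      unfolding filter_on_def
    proof (intro conjI ballI impI)
      show "G \<subseteq> carrier L" by (auto simp: G_def)
      show "lone L \<in> G"
        using one x by (auto simp: G_def intro!: bexI[of _ "lone L"] le_one)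
    next
      fix z w assume "z \<in> G" "w \<in> G"
      then obtain p q where pq: "p \<in> F" "q \<in> F" "le (meet L p x) z" "le (meet L q x) w"
        and zw: "z \<in> carrier L" "w \<in> carrier L" by (auto simp: G_def)
      have p: "p \<in> carrier L" "q \<in> carrier L" using pq FL by auto
      have "le (meet L (meet L p q) x) (meet L p x)" "le (meet L (meet L p q) x) (meet L q x)"
        using p x by (auto intro!: meet_mono meet_le le_refl)
      then have "le (meet L (meet L p q) x) z" "le (meet L (meet L p q) x) w"
        using pq(3,4) zw p x le_trans[of _ "meet L p x" z] le_trans[of _ "meet L q x" w] by auto
      then have "le (meet L (meet L p q) x) (meet L z w)"
        using zw p x by (auto intro: meet_greatest)
      then show "meet L z w \<in> G"
        using meetF[OF pq(1,2)] zw by (auto simp: G_def)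
    next
      fix z w assume "z \<in> G" "w \<in> carrier L" "le z w"
      then obtain p where p: "p \<in> F" "le (meet L p x) z" and z: "z \<in> carrier L"
        by (auto simp: G_def)
      have "le (meet L p x) w"
        using p(1) FL x z \<open>w \<in> carrier L\<close> by (intro le_trans[OF _ z _ p(2) \<open>le z w\<close>]) auto
      then show "w \<in> G" using p(1) \<open>w \<in> carrier L\<close> by (auto simp: G_def)
    qed
    moreover have "F \<subseteq> G"
    proof
      fix p assume "p \<in> F"
      then show "p \<in> G"
        using FL x meet_le(1)[of p x] unfolding G_def by blast
    qed
    moreover have "x \<in> G"
      using one x meet_le(2)[of "lone L" x] by (auto simp: G_def)
    moreover have "b \<notin> G" using neg by (auto simp: G_def)
    ultimately show False
      using max[of G] fil x by (auto simp: \<A>_def)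
  qed
  have "x \<in> F \<or> y \<in> F" if xy: "x \<in> carrier L" "y \<in> carrier L" and j: "join L x y \<in> F" for x y
  proof (rule ccontr)
    assume neg: "\<not> ?thesis"
    obtain p q where pq: "p \<in> F" "q \<in> F" "le (meet L p x) b" "le (meet L q y) b"
      using ext neg xy by blast
    have p: "p \<in> carrier L" "q \<in> carrier L" using pq FL by auto
    let ?r = "meet L p q"
    have "le (meet L ?r x) (meet L p x)" "le (meet L ?r y) (meet L q y)"
      using p xy by (auto intro!: meet_mono meet_le le_refl)
    then have "le (meet L ?r x) b" "le (meet L ?r y) b"
      using p xy b pq(3,4) le_trans[of _ "meet L p x" b] le_trans[of _ "meet L q y" b] by auto
    then have "le (meet L ?r (join L x y)) b"
      using p xy b by (simp add: assoc_distrib(3) join_least)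
    with meetF[OF meetF[OF pq(1,2)] j] upF b fil(3) show False by blast
  qed
  with fil show ?thesis by blast
qed

lemma lat_hom_separation:
  assumes a: "a \<in> carrier L" and b: "b \<in> carrier L" and ab: "\<not> le a b"
  shows "\<exists>\<phi>\<in>lat_hom L two_lat. \<phi> a \<and> \<not> \<phi> b"
proof -
  obtain F where F: "filter_on F" "a \<in> F" "b \<notin> F"
    and prime: "\<And>x y. x \<in> carrier L \<Longrightarrow> y \<in> carrier L \<Longrightarrow> join L x y \<in> F \<Longrightarrow> x \<in> F \<or> y \<in> F"
    using prime_filter_separation[OF assms] by blast
  have up: "\<And>x y. x \<in> F \<Longrightarrow> y \<in> carrier L \<Longrightarrow> le x y \<Longrightarrow> y \<in> F"
    using F(1) by (auto simp: filter_on_def)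
  have "lzero L \<notin> F"
    using up zero_le b F(3) by blast
  moreover have "meet L x y \<in> F \<longleftrightarrow> x \<in> F \<and> y \<in> F" if "x \<in> carrier L" "y \<in> carrier L" for x y
    using that F(1) up[of "meet L x y"] meet_le[of x y] by (auto simp: filter_on_def)
  moreover have "join L x y \<in> F \<longleftrightarrow> x \<in> F \<or> y \<in> F" if "x \<in> carrier L" "y \<in> carrier L" for x y
    using that prime up[of x "join L x y"] up[of y "join L x y"] le_join[of x y] by auto
  ultimately have "(\<lambda>x\<in>carrier L. x \<in> F) \<in> lat_hom L two_lat"
    using F(1) by (auto simp: lat_hom_def two_lat_def filter_on_def)
  then show ?thesis
    using F a b by (intro bexI[of _ "\<lambda>x\<in>carrier L. x \<in> F"]) auto
qed

lemma lat_homs_separate_points: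
  assumes "a \<in> carrier L" "b \<in> carrier L" "\<And>\<phi>. \<phi> \<in> lat_hom L two_lat \<Longrightarrow> \<phi> a = \<phi> b"
  shows "a = b"
  using assms lat_hom_separation le_antisym by metis

end

section \<open>The algebra \<open>N\<close> and its alter ego\<close>

text \<open>The two operations of an algebra, and below those of a structure, are indexed by the letters, so
  that arguments about words need not treat them separately.\<close>

definition ockop :: "'a ockham2 \<Rightarrow> letter \<Rightarrow> 'a \<Rightarrow> 'a" where
  "ockop A l = (case l of e1 \<Rightarrow> fop A | e2 \<Rightarrow> gop A)"

definition uop :: "'y uspace \<Rightarrow> letter \<Rightarrow> 'y \<Rightarrow> 'y" where
  "uop Y l = (case l of e1 \<Rightarrow> u1 Y | e2 \<Rightarrow> u2 Y)"

lemma all_letter_iff: "(\<forall>l. P l) \<longleftrightarrow> P e1 \<and> P e2"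
  by (metis letter.exhaust)

text \<open>The order of \<open>N\<close> reverses at odd words. Negating the coordinates at odd words makes it
  the coordinatewise order and embeds \<open>N\<close> as a Priestley space into a power of \<open>2\<close>.\<close>

definition signed :: "word \<Rightarrow> N \<Rightarrow> bool" where
  "signed s a \<longleftrightarrow> a s \<noteq> odd (length s)"

lemma N_alg_simps [simp]:
  "carrier N_alg = UNIV"
  "join N_alg a b = (\<lambda>s. a s \<or> b s)"
  "meet N_alg a b = (\<lambda>s. a s \<and> b s)"
  "lzero N_alg = (\<lambda>s. False)"
  "lone N_alg = (\<lambda>s. True)"
  "ockop N_alg l a = (\<lambda>s. \<not> a (s @ [l]))"
  by (cases l; simp add: N_alg_def ockop_def)+

lemma two_lat_simps [simp]:
  "carrier two_lat = UNIV" "join two_lat = (\<or>)" "meet two_lat = (\<and>)"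
  "lzero two_lat = False" "lone two_lat = True"
  by (simp_all add: two_lat_def)

lemma N_str_simps [simp]:
  "topo N_str = product_topology (\<lambda>_. two_top) UNIV"
  "uop N_str l a = (\<lambda>s. a (l # s))"
  by (cases l; simp add: N_str_def uop_def)+

lemma pts_N_str: "pts N_str = UNIV"
  by simp

lemma two_space_simps [simp]: "topo two_space = two_top" "leq two_space p q \<longleftrightarrow> (p \<longrightarrow> q)"
  by (auto simp: two_space_def)

lemma leq_N_iff: "leq N_str a b \<longleftrightarrow> (\<forall>s. signed s a \<longrightarrow> signed s b)"
  by (auto simp: N_str_def signed_def)

lemma N_eqI: "leq N_str a b \<Longrightarrow> leq N_str b a \<Longrightarrow> a = b"
  by (auto simp: leq_N_iff signed_def)

lemma compact_Hausdorff_power: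
  "compact_space (product_topology (\<lambda>_. two_top) I)"
  "Hausdorff_space (product_topology (\<lambda>_. two_top) I)"
  "compact_space (product_topology (\<lambda>_. topo N_str) J)"
  "Hausdorff_space (product_topology (\<lambda>_. topo N_str) J)"
  by (auto simp: compact_space_product_topology Hausdorff_space_product_topology
      compact_space_discrete_topology)

lemma flat_simps [simp]:
  "carrier (lat_flat A) = carrier A" "join (lat_flat A) = join A" "meet (lat_flat A) = meet A"
  "lzero (lat_flat A) = lzero A" "lone (lat_flat A) = lone A"
  "topo (ord_flat Y) = topo Y" "leq (ord_flat Y) = leq Y"
  by (simp_all add: blattice.defs ordspace.defs)

lemma hom_flat [simp]:
  "lat_hom (lat_flat A) M = lat_hom A M"
  "ord_mor (ord_flat Y) Q = ord_mor Y Q"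
  "bounded_distributive_lattice (lat_flat A) = bounded_distributive_lattice A"
  by (simp_all add: lat_hom_def ord_mor_def bounded_distributive_lattice_def)

lemma power_simps [simp]:
  "topo (ord_power I two_space) = product_topology (\<lambda>_. two_top) I"
  "leq (ord_power I two_space) x y \<longleftrightarrow> (\<forall>i\<in>I. x i \<longrightarrow> y i)"
  "topo (u_power I N_str) = product_topology (\<lambda>_. topo N_str) I"
  "leq (u_power I N_str) v w \<longleftrightarrow> (\<forall>i\<in>I. leq N_str (v i) (w i))"
  "uop (u_power I N_str) l v = (\<lambda>i\<in>I. uop N_str l (v i))"
  by (cases l; simp add: u_power_def ord_power_def uop_def ordspace.defs uspace.defs del: N_str_simps)+

lemma on_subset_simps [simp]:
  "topo (on_subset X S) = subtopology (topo X) S"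
  "leq (on_subset X S) = leq X"
  "uop (on_subset Z S) l = uop Z l"
  by (cases l; simp add: on_subset_def uop_def)+

lemma D_obj_simps:
  "topo (D_obj A) = subtopology (product_topology (\<lambda>_. topo N_str) (carrier A)) (ock_hom A N_alg)"
  "pts (D_obj A) = ock_hom A N_alg"
  "leq (D_obj A) x y \<longleftrightarrow> (\<forall>a\<in>carrier A. leq N_str (x a) (y a))"
  "uop (D_obj A) l x = (\<lambda>a\<in>carrier A. uop N_str l (x a))"
  by (auto simp: D_obj_def ock_hom_def lat_hom_def)

lemma H_obj_simps:
  "topo (H_obj (lat_flat A)) = subtopology (product_topology (\<lambda>_. two_top) (carrier A)) (lat_hom A two_lat)"
  "pts (H_obj (lat_flat A)) = lat_hom A two_lat"
  "leq (H_obj (lat_flat A)) x y \<longleftrightarrow> (\<forall>a\<in>carrier A. x a \<longrightarrow> y a)"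
  by (auto simp: H_obj_def lat_hom_def)

lemma E_obj_simps:
  "carrier (E_obj Y) = u_mor Y N_str"
  "join (E_obj Y) \<alpha> \<beta> = (\<lambda>y\<in>pts Y. join N_alg (\<alpha> y) (\<beta> y))"
  "meet (E_obj Y) \<alpha> \<beta> = (\<lambda>y\<in>pts Y. meet N_alg (\<alpha> y) (\<beta> y))"
  "lzero (E_obj Y) = (\<lambda>y\<in>pts Y. lzero N_alg)"
  "lone (E_obj Y) = (\<lambda>y\<in>pts Y. lone N_alg)"
  "ockop (E_obj Y) l \<alpha> = (\<lambda>y\<in>pts Y. ockop N_alg l (\<alpha> y))"
  by (cases l; simp add: E_obj_def ock_power_def lat_power_def ockop_def blattice.defs ockham2.defs
      del: N_alg_simps)+

lemma K_obj_simps: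
  "carrier (K_obj X) = ord_mor X two_space"
  "join (K_obj X) \<alpha> \<beta> = (\<lambda>y\<in>pts X. \<alpha> y \<or> \<beta> y)"
  "meet (K_obj X) \<alpha> \<beta> = (\<lambda>y\<in>pts X. \<alpha> y \<and> \<beta> y)"
  "lzero (K_obj X) = (\<lambda>y\<in>pts X. False)"
  "lone (K_obj X) = (\<lambda>y\<in>pts X. True)"
  by (simp_all add: K_obj_def lat_power_def)

lemma ock_hom_iff:
  "h \<in> ock_hom A B \<longleftrightarrow>
     h \<in> lat_hom A B \<and> (\<forall>l. \<forall>x\<in>carrier A. h (ockop A l x) = ockop B l (h x))"
  by (auto simp: ock_hom_def all_letter_iff ockop_def)

lemma u_mor_iff:
  "h \<in> u_mor X Y \<longleftrightarrow>
     h \<in> ord_mor X Y \<and> (\<forall>l. \<forall>x\<in>pts X. h (uop X l x) = uop Y l (h x))"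
  by (auto simp: u_mor_def all_letter_iff uop_def)

lemma double_Ockham_iff:
  "double_Ockham A \<longleftrightarrow>
     bounded_distributive_lattice A \<and> (\<forall>l. dual_endomorphism A (ockop A l))"
  by (auto simp: double_Ockham_def all_letter_iff ockop_def)

lemma u_closed_iff: "u_closed X S \<longleftrightarrow> (\<forall>l. \<forall>x\<in>S. uop X l x \<in> S)"
  by (auto simp: u_closed_def all_letter_iff uop_def)

lemma bdl_N_two: "bounded_distributive_lattice N_alg" "bounded_distributive_lattice two_lat"
  by (auto simp: bounded_distributive_lattice_def)

lemma continuous_map_power_iff:
  "continuous_map X (product_topology (\<lambda>_. T) I) f \<longleftrightarrow>
     f \<in> topspace X \<rightarrow> extensional I \<and> (\<forall>i\<in>I. continuous_map X T (\<lambda>x. f x i))"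
  by (auto simp: continuous_map_componentwise)

lemma continuous_map_power_coordinate:
  "i \<in> I \<Longrightarrow> continuous_map (subtopology (product_topology (\<lambda>_. T) I) S) T (\<lambda>x. x i)"
  by (intro continuous_map_from_subtopology continuous_map_product_projection)

lemma continuous_map_N_iff:
  "continuous_map X (topo N_str) f \<longleftrightarrow> (\<forall>s. continuous_map X two_top (\<lambda>x. f x s))"
  by (simp add: continuous_map_componentwise_UNIV)

lemma omega_mor: "omega \<in> lat_hom N_alg two_lat" "omega \<in> ord_mor N_str two_space"
proof -
  show "omega \<in> lat_hom N_alg two_lat"
    by (auto simp: lat_hom_def omega_def)
  have "continuous_map (topo N_str) two_top (\<lambda>a. a [])"
    unfolding N_str_simps by (rule continuous_map_product_projection) simp
  then have "continuous_map (topo N_str) two_top omega"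
    by (simp add: omega_def[abs_def])
  moreover have "omega a \<longrightarrow> omega b" if "leq N_str a b" for a b
    using that[unfolded leq_N_iff, rule_format, of "[]"] by (simp add: omega_def signed_def)
  ultimately show "omega \<in> ord_mor N_str two_space"
    by (simp add: ord_mor_def)
qed

section \<open>Homomorphisms into \<open>N\<close>\<close>

text \<open>The last letter acts first, because the operations of \<open>N\<close> append letters on the right.\<close>

definition word_op :: "'a ockham2 \<Rightarrow> word \<Rightarrow> 'a \<Rightarrow> 'a" where
  "word_op A s = foldr (ockop A) s"

lemma word_op_simps [simp]:
  "word_op A [] a = a"
  "word_op A (l # s) a = ockop A l (word_op A s a)"
  "word_op A (s @ [l]) a = word_op A s (ockop A l a)"
  by (simp_all add: word_op_def)

text \<open>The homomorphism into \<open>N\<close> that lies over a lattice homomorphism \<open>\<phi>\<close>. The operations of \<open>N\<close>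
  complement the values, which accounts for one negation per letter.\<close>

definition lift_alg :: "'a ockham2 \<Rightarrow> ('a \<Rightarrow> bool) \<Rightarrow> 'a \<Rightarrow> N" where
  "lift_alg A \<phi> = (\<lambda>a\<in>carrier A. \<lambda>s. \<phi> (word_op A s a) \<noteq> odd (length s))"

locale ockham_algebra =
  fixes A :: "'a ockham2"
  assumes dO: "double_Ockham A"

sublocale ockham_algebra \<subseteq> bd_lattice A
  by unfold_locales (use dO in \<open>simp add: double_Ockham_def\<close>)

context ockham_algebra
begin

lemma ockop_dual:
  "dual_endomorphism A (ockop A l)"
  using dO by (simp add: double_Ockham_iff)

lemma ockop_closed [simp]: "a \<in> carrier A \<Longrightarrow> ockop A l a \<in> carrier A"
  using ockop_dual[of l] by (simp add: dual_endomorphism_def)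

lemma word_op_closed [simp]: "a \<in> carrier A \<Longrightarrow> word_op A s a \<in> carrier A"
  by (induction s) auto

lemma word_op_endo:
  assumes "a \<in> carrier A" "b \<in> carrier A"
  shows "word_op A s (join A a b) =
      (if even (length s) then join A else meet A) (word_op A s a) (word_op A s b)"
    and "word_op A s (meet A a b) =
      (if even (length s) then meet A else join A) (word_op A s a) (word_op A s b)"
  using assms ockop_dual by (induction s) (auto simp: dual_endomorphism_def)

lemma word_op_bounds:
  "word_op A s (lzero A) = (if even (length s) then lzero A else lone A)"
  "word_op A s (lone A) = (if even (length s) then lone A else lzero A)"
  using ockop_dual by (induction s) (auto simp: dual_endomorphism_def)

text \<open>Peeling off the last letter of \<open>s\<close> applies one operation to the argument and negates the value, so
  a homomorphism is controlled by its composite with \<open>\<omega>\<close>.\<close>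

lemma ock_hom_N_determined:
  assumes x: "x \<in> ock_hom A N_alg" and "a \<in> carrier A"
  shows "x a s \<longleftrightarrow> omega (x (word_op A s a)) \<noteq> odd (length s)"
  using \<open>a \<in> carrier A\<close>
proof (induction s arbitrary: a rule: rev_induct)
  case Nil
  then show ?case by (simp add: omega_def)
next
  case (snoc l s)
  have "x (ockop A l a) s \<longleftrightarrow> \<not> x a (s @ [l])"
    using x snoc.prems by (simp add: ock_hom_iff)
  with snoc.IH[of "ockop A l a"] snoc.prems show ?case by auto
qed

lemma ock_hom_N_eqI:
  assumes "x \<in> ock_hom A N_alg" "x' \<in> ock_hom A N_alg"
    and "\<And>a. a \<in> carrier A \<Longrightarrow> omega (x a) = omega (x' a)"
  shows "x = x'"
proof (rule extensionalityI[of _ "carrier A"])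
  show "x \<in> extensional (carrier A)" "x' \<in> extensional (carrier A)"
    using assms by (auto simp: ock_hom_def lat_hom_def PiE_def)
  show "x a = x' a" if "a \<in> carrier A" for a
    using ock_hom_N_determined[OF assms(1) that] ock_hom_N_determined[OF assms(2) that]
      assms(3)[OF word_op_closed[OF that]] by (intro ext) simp
qed

lemma omega_lift_alg: "a \<in> carrier A \<Longrightarrow> omega (lift_alg A \<phi> a) = \<phi> a"
  by (simp add: lift_alg_def omega_def)

text \<open>For even \<open>s\<close> the word acts as an endomorphism and no sign is present; for odd \<open>s\<close> it acts as a
  dual endomorphism and the sign undoes the exchange of join and meet.\<close>

lemma lift_alg_hom:
  assumes "\<phi> \<in> lat_hom A two_lat"
  shows "lift_alg A \<phi> \<in> ock_hom A N_alg"
proof -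
  have \<phi>: "\<phi> (lzero A) = False" "\<phi> (lone A) = True"
    "\<And>a b. a \<in> carrier A \<Longrightarrow> b \<in> carrier A \<Longrightarrow> \<phi> (join A a b) = (\<phi> a \<or> \<phi> b)"
    "\<And>a b. a \<in> carrier A \<Longrightarrow> b \<in> carrier A \<Longrightarrow> \<phi> (meet A a b) = (\<phi> a \<and> \<phi> b)"
    using assms by (auto simp: lat_hom_def)
  show ?thesis
    unfolding ock_hom_iff lat_hom_def
    by (auto simp: lift_alg_def word_op_endo word_op_bounds \<phi> fun_eq_iff)
qed

lemma compose_omega_ock_hom:
  "x \<in> ock_hom A N_alg \<Longrightarrow> compose (carrier A) omega x \<in> lat_hom A two_lat"
  by (auto simp: ock_hom_def lat_hom_def compose_def omega_def)

text \<open>At every word the sign in the recovered coordinate cancels the reversal of the order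
  of \<open>N\<close>, so all coordinates compare as the values of \<open>\<omega>\<close> do.\<close>

lemma leq_D_iff:
  assumes "x \<in> ock_hom A N_alg" "x' \<in> ock_hom A N_alg"
  shows "leq (D_obj A) x x' \<longleftrightarrow> (\<forall>a\<in>carrier A. omega (x a) \<longrightarrow> omega (x' a))"
proof
  assume "leq (D_obj A) x x'"
  then show "\<forall>a\<in>carrier A. omega (x a) \<longrightarrow> omega (x' a)"
    using omega_mor(2) by (auto simp: D_obj_simps(3) ord_mor_def)
next
  assume "\<forall>a\<in>carrier A. omega (x a) \<longrightarrow> omega (x' a)"
  then show "leq (D_obj A) x x'"
    using assms[THEN ock_hom_N_determined]
    by (auto simp: D_obj_simps(3) leq_N_iff signed_def)
qed

end

section \<open>Isomorphisms of topological structures\<close>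

text \<open>A continuous bijection from a compact space to a Hausdorff space is a homeomorphism, so only the
  order has to be reflected by hand.\<close>

lemma ord_isoI_compact:
  assumes cpt: "compact_space (topo X)" and T2: "Hausdorff_space (topo Y)"
    and h: "h \<in> ord_mor X Y" and onto: "h ` pts X = pts Y" and inj: "inj_on h (pts X)"
    and refl: "\<And>x x'. x \<in> pts X \<Longrightarrow> x' \<in> pts X \<Longrightarrow> leq Y (h x) (h x') \<Longrightarrow> leq X x x'"
  shows "ord_iso X Y h"
proof -
  have "homeomorphic_map (topo X) (topo Y) h"
    using h by (intro continuous_imp_homeomorphic_map cpt T2 onto inj) (simp add: ord_mor_def)
  then obtain g where g: "homeomorphic_maps (topo X) (topo Y) h g"
    unfolding homeomorphic_map_maps by blast
  define k where "k = restrict g (pts Y)"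
  have k: "k (h x) = x" if "x \<in> pts X" for x
    using g that onto unfolding homeomorphic_maps_def k_def by auto
  have hk: "k y \<in> pts X" "h (k y) = y" if "y \<in> pts Y" for y
    using onto k that by (metis imageE)+
  have "continuous_map (topo Y) (topo X) k"
    using g by (auto simp: homeomorphic_maps_def k_def intro: continuous_map_eq)
  moreover have "leq X (k y) (k y')" if "y \<in> pts Y" "y' \<in> pts Y" "leq Y y y'" for y y'
    using that hk refl[of "k y" "k y'"] by simp
  ultimately have "k \<in> ord_mor Y X"
    using hk by (auto simp: ord_mor_def k_def)
  then show ?thesis
    unfolding ord_iso_def using h k hk by auto
qed

lemma u_isoI:
  assumes iso: "ord_iso X Y h" and mor: "h \<in> u_mor X Y" and X: "u_closed X (pts X)"
  shows "u_iso X Y h"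
proof -
  obtain k where k: "k \<in> ord_mor Y X" "\<And>x. x \<in> pts X \<Longrightarrow> k (h x) = x" "\<And>y. y \<in> pts Y \<Longrightarrow> h (k y) = y"
    using iso unfolding ord_iso_def by auto
  have "k (uop Y l y) = uop X l (k y)" if "y \<in> pts Y" for l y
  proof -
    have ky: "k y \<in> pts X" using k(1) that by (auto simp: ord_mor_def)
    then have "h (uop X l (k y)) = uop Y l y" using mor k(3)[OF that] by (simp add: u_mor_iff)
    moreover have "uop X l (k y) \<in> pts X" using X ky by (simp add: u_closed_iff)
    ultimately show ?thesis using k(2) by metis
  qed
  then have "k \<in> u_mor Y X" using k(1) by (simp add: u_mor_iff)
  then show ?thesis unfolding u_iso_def using mor k by blast
qed

lemma ord_iso_id: "ord_iso X X (\<lambda>x\<in>pts X. x)"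
proof -
  have "continuous_map (topo X) (topo X) (\<lambda>x\<in>pts X. x)"
    by (rule continuous_map_eq[OF continuous_map_id]) simp
  then have "(\<lambda>x\<in>pts X. x) \<in> ord_mor X X" by (simp add: ord_mor_def)
  then show ?thesis unfolding ord_iso_def by (auto intro!: bexI[of _ "\<lambda>x\<in>pts X. x"])
qed

lemma u_iso_id: "u_closed X (pts X) \<Longrightarrow> u_iso X X (\<lambda>x\<in>pts X. x)"
  using ord_iso_id[of X] by (intro u_isoI) (auto simp: u_mor_iff ord_iso_def u_closed_iff)

section \<open>The dual of a double Ockham algebra\<close>

lemma closedin_Collect_ball:
  assumes "\<And>i. i \<in> I \<Longrightarrow> closedin X {x \<in> topspace X. P i x}"
  shows "closedin X {x \<in> topspace X. \<forall>i\<in>I. P i x}"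
proof (cases "I = {}")
  case False
  then have "{x \<in> topspace X. \<forall>i\<in>I. P i x} = (\<Inter>i\<in>I. {x \<in> topspace X. P i x})" by auto
  with assms False show ?thesis by (simp add: closedin_INT)
qed simp

lemma closedin_Collect_conj:
  assumes "closedin X {x \<in> topspace X. P x}" "closedin X {x \<in> topspace X. Q x}"
  shows "closedin X {x \<in> topspace X. P x \<and> Q x}"
proof -
  have "{x \<in> topspace X. P x \<and> Q x} = {x \<in> topspace X. P x} \<inter> {x \<in> topspace X. Q x}" by auto
  with assms show ?thesis by (simp add: closedin_Int)
qed

text \<open>Being a homomorphism is a system of equations between continuous functions of the coordinates,
  with values in a Hausdorff space.\<close>

lemma closedin_lat_hom:
  assumes L: "bounded_distributive_lattice L" and M: "bounded_distributive_lattice M"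
    and T2: "Hausdorff_space T" and T: "topspace T = carrier M"
    and join: "\<And>f g. continuous_map (product_topology (\<lambda>_. T) (carrier L)) T f \<Longrightarrow>
        continuous_map (product_topology (\<lambda>_. T) (carrier L)) T g \<Longrightarrow>
        continuous_map (product_topology (\<lambda>_. T) (carrier L)) T (\<lambda>x. join M (f x) (g x))"
    and meet: "\<And>f g. continuous_map (product_topology (\<lambda>_. T) (carrier L)) T f \<Longrightarrow>
        continuous_map (product_topology (\<lambda>_. T) (carrier L)) T g \<Longrightarrow>
        continuous_map (product_topology (\<lambda>_. T) (carrier L)) T (\<lambda>x. meet M (f x) (g x))"
  shows "closedin (product_topology (\<lambda>_. T) (carrier L)) (lat_hom L M)"
proof -
  interpret L: bd_lattice L by unfold_locales (rule L)
  interpret M: bd_lattice M by unfold_locales (rule M)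
  let ?P = "product_topology (\<lambda>_. T) (carrier L)"
  have top: "topspace ?P = carrier L \<rightarrow>\<^sub>E carrier M" by (simp add: T)
  have "lat_hom L M = {h \<in> topspace ?P.
      (\<forall>x\<in>carrier L. \<forall>y\<in>carrier L.
        h (join L x y) = join M (h x) (h y) \<and> h (meet L x y) = meet M (h x) (h y)) \<and>
      h (lzero L) = lzero M \<and> h (lone L) = lone M}"
    unfolding top lat_hom_def ..
  also have "closedin ?P \<dots>"
    by (intro closedin_Collect_conj closedin_Collect_ball closedin_continuous_maps_eq[OF T2]
        join meet continuous_map_product_projection L.closed) (simp_all add: T)
  finally show ?thesis .
qed

lemma closedin_lat_hom_two:
  assumes "bounded_distributive_lattice L"
  shows "closedin (product_topology (\<lambda>_. two_top) (carrier L)) (lat_hom L two_lat)"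
  by (rule closedin_lat_hom[OF assms bdl_N_two(2)])
    (auto intro: continuous_map_two_top_conj continuous_map_two_top_disj)

lemma continuous_map_N_algebra:
  assumes "continuous_map X (topo N_str) f" "continuous_map X (topo N_str) g"
  shows "continuous_map X (topo N_str) (\<lambda>x. join N_alg (f x) (g x))"
    and "continuous_map X (topo N_str) (\<lambda>x. meet N_alg (f x) (g x))"
  using assms unfolding continuous_map_N_iff
  by (simp_all add: continuous_map_two_top_intros)

lemma continuous_map_N_unary:
  assumes "continuous_map X (topo N_str) f"
  shows "continuous_map X (topo N_str) (\<lambda>x. ockop N_alg l (f x))"
    and "continuous_map X (topo N_str) (\<lambda>x. uop N_str l (f x))"
  using assms unfolding continuous_map_N_iff
  by (simp_all add: continuous_map_two_top_intros)

context ockham_algebra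
begin

lemma closedin_ock_hom:
  "closedin (product_topology (\<lambda>_. topo N_str) (carrier A)) (ock_hom A N_alg)"
proof -
  let ?P = "product_topology (\<lambda>_. topo N_str) (carrier A)"
  have T2: "Hausdorff_space (topo N_str)" using compact_Hausdorff_power(2) by simp
  have "closedin ?P (lat_hom A N_alg)"
    by (rule closedin_lat_hom[OF bdl bdl_N_two(1) T2])
      (auto simp del: N_alg_simps(2,3) N_str_simps intro: continuous_map_N_algebra, simp)
  moreover have "closedin ?P {x \<in> topspace ?P. \<forall>l\<in>UNIV. \<forall>a\<in>carrier A. x (ockop A l a) = ockop N_alg l (x a)}"
    by (intro closedin_Collect_ball closedin_continuous_maps_eq[OF T2] continuous_map_N_unary
        continuous_map_product_projection ockop_closed)
  moreover have "ock_hom A N_alg = lat_hom A N_alg \<inter>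
      {x \<in> topspace ?P. \<forall>l\<in>UNIV. \<forall>a\<in>carrier A. x (ockop A l a) = ockop N_alg l (x a)}"
    by (auto simp: ock_hom_iff lat_hom_def)
  ultimately show ?thesis by (simp only: closedin_Int)
qed

lemma compact_D: "compact_space (topo (D_obj A))"
  unfolding D_obj_simps
  by (intro compact_space_subtopology closedin_compact_space compact_Hausdorff_power closedin_ock_hom)

lemma u_closed_D: "u_closed (D_obj A) (ock_hom A N_alg)"
proof -
  have "(\<lambda>a\<in>carrier A. uop N_str l (x a)) \<in> ock_hom A N_alg" if "x \<in> ock_hom A N_alg" for l x
    using that unfolding ock_hom_iff lat_hom_def by auto
  then show ?thesis by (simp add: u_closed_iff D_obj_simps del: N_str_simps)
qed

lemma in_Y_D: "in_Y TYPE('a) (D_obj A)"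
proof -
  have u: "u_closed (D_obj A) (pts (D_obj A))"
    using u_closed_D by (simp add: D_obj_simps(2))
  have "closed_substructure (u_power (carrier A) N_str) (ock_hom A N_alg)"
    unfolding closed_substructure_def
    using closedin_ock_hom u_closed_D by (simp add: u_closed_iff D_obj_simps del: N_str_simps)
  moreover have "carrier A \<noteq> {}" by (metis closed(1) empty_iff)
  ultimately show ?thesis
    unfolding in_Y_def using u u_iso_id[OF u] by (metis D_obj_def)
qed

text \<open>Unique lifting along \<open>\<omega>\<close> makes \<open>\<Phi>\<close> a bijection; compactness of the domain supplies continuity of
  the inverse.\<close>

lemma ord_iso_Phi: "ord_iso (D_obj A) (H_obj (lat_flat A)) (Phi A)"
proof (rule ord_isoI_compact[OF compact_D])
  have Phi: "Phi A x = (\<lambda>a\<in>carrier A. omega (x a))" if "x \<in> ock_hom A N_alg" for x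
    using that by (simp add: Phi_def D_obj_simps(2) compose_def)
  show "Hausdorff_space (topo (H_obj (lat_flat A)))"
    unfolding H_obj_simps by (intro Hausdorff_space_subtopology compact_Hausdorff_power)
  show "leq (D_obj A) x x'"
    if "x \<in> pts (D_obj A)" "x' \<in> pts (D_obj A)"
      "leq (H_obj (lat_flat A)) (Phi A x) (Phi A x')" for x x'
    using that by (simp add: D_obj_simps(2) H_obj_simps Phi leq_D_iff)
  show "inj_on (Phi A) (pts (D_obj A))"
  proof (rule inj_onI)
    fix x x' assume x: "x \<in> pts (D_obj A)" "x' \<in> pts (D_obj A)" and eq: "Phi A x = Phi A x'"
    show "x = x'"
    proof (rule ock_hom_N_eqI)
      show "omega (x a) = omega (x' a)" if "a \<in> carrier A" for a
        using fun_cong[OF eq, of a] x that by (simp add: Phi D_obj_simps(2))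
    qed (use x in \<open>simp_all add: D_obj_simps(2)\<close>)
  qed
  have hom: "Phi A x \<in> lat_hom A two_lat" if "x \<in> ock_hom A N_alg" for x
    using compose_omega_ock_hom[OF that] that by (simp add: Phi compose_def)
  show "Phi A ` pts (D_obj A) = pts (H_obj (lat_flat A))"
    unfolding D_obj_simps(2) H_obj_simps(2)
  proof (intro equalityI subsetI)
    fix \<phi> assume \<phi>: "\<phi> \<in> lat_hom A two_lat"
    then have "\<phi> = Phi A (lift_alg A \<phi>)"
      by (intro extensionalityI[of _ "carrier A"])
        (auto simp: Phi lift_alg_hom omega_lift_alg lat_hom_def PiE_iff)
    then show "\<phi> \<in> Phi A ` ock_hom A N_alg" using lift_alg_hom[OF \<phi>] by blast
  qed (use hom in auto)
  have "continuous_map (topo (D_obj A)) two_top (\<lambda>x. omega (x a))" if "a \<in> carrier A" for a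
  proof -
    have "continuous_map (topo (D_obj A)) (topo N_str) (\<lambda>x. x a)"
      unfolding D_obj_simps by (rule continuous_map_power_coordinate[OF that])
    then show ?thesis by (simp add: continuous_map_N_iff omega_def del: N_str_simps)
  qed
  then have "continuous_map (topo (D_obj A)) (product_topology (\<lambda>_. two_top) (carrier A))
      (\<lambda>x. \<lambda>a\<in>carrier A. omega (x a))"
    by (simp add: continuous_map_power_iff)
  then have "continuous_map (topo (D_obj A)) (product_topology (\<lambda>_. two_top) (carrier A)) (Phi A)"
    by (rule continuous_map_eq) (simp add: Phi D_obj_simps(2))
  then have "continuous_map (topo (D_obj A)) (topo (H_obj (lat_flat A))) (Phi A)"
    unfolding H_obj_simps
    by (rule continuous_map_into_subtopology) (use hom in \<open>simp add: D_obj_simps(2) Pi_iff\<close>)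
  moreover have "Phi A \<in> extensional (pts (D_obj A))" by (simp add: Phi_def)
  moreover have "leq (H_obj (lat_flat A)) (Phi A x) (Phi A x')"
    if "x \<in> ock_hom A N_alg" "x' \<in> ock_hom A N_alg" "leq (D_obj A) x x'" for x x'
    using that by (simp add: leq_D_iff H_obj_simps Phi)
  ultimately show "Phi A \<in> ord_mor (D_obj A) (H_obj (lat_flat A))"
    using hom by (simp add: ord_mor_def PiE_iff D_obj_simps(2) H_obj_simps(2))
qed

lemma in_P_D_H: "in_P TYPE('a) (ord_flat (D_obj A))" "in_P TYPE('a) (H_obj (lat_flat A))"
proof -
  have clo: "closedin (topo (ord_power (carrier A) two_space)) (lat_hom A two_lat)"
    using closedin_lat_hom_two[OF bdl] by simp
  have ne: "carrier A \<noteq> {}" by (metis closed(1) empty_iff)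
  have H: "H_obj (lat_flat A) = on_subset (ord_power (carrier A) two_space) (lat_hom A two_lat)"
    by (simp add: H_obj_def)
  show "in_P TYPE('a) (H_obj (lat_flat A))"
    unfolding in_P_def H using ne clo ord_iso_id by blast
  have "ord_iso (ord_flat (D_obj A)) (H_obj (lat_flat A)) (Phi A)"
    using ord_iso_Phi by (simp add: ord_iso_def ord_mor_def)
  then show "in_P TYPE('a) (ord_flat (D_obj A))"
    unfolding in_P_def H using ne clo by blast
qed

end

section \<open>The dual of a topological structure\<close>

lemma bdl_power:
  assumes "bounded_distributive_lattice M"
  shows "bounded_distributive_lattice (lat_power I M)"
proof -
  interpret M: bd_lattice M by unfold_locales (rule assms)
  have eqI: "x = y" if "x \<in> I \<rightarrow>\<^sub>E carrier M" "y \<in> I \<rightarrow>\<^sub>E carrier M" "\<And>i. i \<in> I \<Longrightarrow> x i = y i" for x y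
    using that by (rule PiE_ext)
  have in_M: "x i \<in> carrier M" if "x \<in> I \<rightarrow>\<^sub>E carrier M" "i \<in> I" for x i
    using that by (rule PiE_mem)
  have comm: "join M (x i) (y i) = join M (y i) (x i)" "meet M (x i) (y i) = meet M (y i) (x i)"
    if "x \<in> I \<rightarrow>\<^sub>E carrier M" "y \<in> I \<rightarrow>\<^sub>E carrier M" "i \<in> I" for x y i
    using that by (simp_all add: M.laws(1,2) in_M)
  show ?thesis
    unfolding bounded_distributive_lattice_def lat_power_def
    by (auto intro!: eqI simp: in_M M.laws(3,4) M.unit_laws M.assoc_distrib intro: comm)
qed

text \<open>\<open>L'\<close> is a separate record, linked to \<open>L\<close> by equations, so that one of the two may carry extra
  fields.\<close>

lemma bdl_subalgebra:
  assumes L: "bounded_distributive_lattice (L :: ('a, 'r) blattice_scheme)"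
    and S: "S \<subseteq> carrier L" "lzero L \<in> S" "lone L \<in> S"
      "\<And>x y. x \<in> S \<Longrightarrow> y \<in> S \<Longrightarrow> join L x y \<in> S"
      "\<And>x y. x \<in> S \<Longrightarrow> y \<in> S \<Longrightarrow> meet L x y \<in> S"
    and L': "carrier L' = S" "join L' = join L" "meet L' = meet L" "lzero L' = lzero L" "lone L' = lone L"
  shows "bounded_distributive_lattice L'"
proof -
  interpret bd_lattice L by unfold_locales (rule L)
  have in_L: "x \<in> carrier L" if "x \<in> S" for x using that S(1) by blast
  show ?thesis
    unfolding bounded_distributive_lattice_def L'
    by (auto simp: S(2-) in_L laws(3,4) unit_laws assoc_distrib intro: laws(1,2))
qed

lemma lat_isoI_bij:
  assumes L: "bounded_distributive_lattice L" and h: "h \<in> lat_hom L M"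
    and bij: "bij_betw h (carrier L) (carrier M)"
  shows "lat_iso L M h"
proof -
  interpret bd_lattice L by unfold_locales (rule L)
  define k where "k = restrict (inv_into (carrier L) h) (carrier M)"
  have kh: "k (h x) = x" if "x \<in> carrier L" for x
    using bij that bij_betwE[OF bij] by (simp add: k_def bij_betw_inv_into_left)
  have hk: "h (k y) = y" "k y \<in> carrier L" if "y \<in> carrier M" for y
    using bij that bij_betwE[OF bij_betw_inv_into[OF bij]]
    by (simp_all add: k_def bij_betw_inv_into_right)
  have ops: "h (join L x y) = join M (h x) (h y)" "h (meet L x y) = meet M (h x) (h y)"
    if "x \<in> carrier L" "y \<in> carrier L" for x y
    using h that by (simp_all add: lat_hom_def)
  have "k (join M x y) = join L (k x) (k y)" "k (meet M x y) = meet L (k x) (k y)"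
    if "x \<in> carrier M" "y \<in> carrier M" for x y
    using ops[of "k x" "k y"] hk[OF that(1)] hk[OF that(2)]
      kh[of "join L (k x) (k y)"] kh[of "meet L (k x) (k y)"] by simp_all
  moreover have "k (lzero M) = lzero L" "k (lone M) = lone L"
    using h kh[of "lzero L"] kh[of "lone L"] by (simp_all add: lat_hom_def)
  ultimately have "k \<in> lat_hom M L"
    using hk(2) by (simp add: lat_hom_def k_def)
  then show ?thesis
    unfolding lat_iso_def using h kh hk by auto
qed

lemma ord_mor_two_lattice:
  assumes "\<phi> \<in> ord_mor X two_space" "\<psi> \<in> ord_mor X two_space"
  shows "(\<lambda>x\<in>pts X. \<phi> x \<or> \<psi> x) \<in> ord_mor X two_space"
    and "(\<lambda>x\<in>pts X. \<phi> x \<and> \<psi> x) \<in> ord_mor X two_space"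
proof -
  have c: "continuous_map (topo X) two_top \<phi>" "continuous_map (topo X) two_top \<psi>"
    using assms by (auto simp: ord_mor_def)
  have "continuous_map (topo X) two_top (\<lambda>x\<in>pts X. \<phi> x \<or> \<psi> x)"
    by (rule continuous_map_eq[OF continuous_map_two_top_disj[OF c]]) simp
  then show "(\<lambda>x\<in>pts X. \<phi> x \<or> \<psi> x) \<in> ord_mor X two_space"
    using assms by (auto simp: ord_mor_def)
  have "continuous_map (topo X) two_top (\<lambda>x\<in>pts X. \<phi> x \<and> \<psi> x)"
    by (rule continuous_map_eq[OF continuous_map_two_top_conj[OF c]]) simp
  then show "(\<lambda>x\<in>pts X. \<phi> x \<and> \<psi> x) \<in> ord_mor X two_space"
    using assms by (auto simp: ord_mor_def)
qed

lemma ord_mor_const: "c \<in> pts Y \<Longrightarrow> leq Y c c \<Longrightarrow> (\<lambda>x\<in>pts X. c) \<in> ord_mor X Y"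
proof -
  assume c: "c \<in> pts Y" "leq Y c c"
  have "continuous_map (topo X) (topo Y) (\<lambda>x\<in>pts X. c)"
    by (rule continuous_map_eq[of _ _ "\<lambda>x. c"]) (use c in auto)
  with c show ?thesis by (simp add: ord_mor_def)
qed

lemma bdl_K: "bounded_distributive_lattice (K_obj X)"
proof (rule bdl_subalgebra[OF bdl_power[OF bdl_N_two(2), of "pts X"]])
  show "ord_mor X two_space \<subseteq> carrier (lat_power (pts X) two_lat)"
    by (auto simp: ord_mor_def lat_power_def)
qed (auto simp: K_obj_def lat_power_def ord_mor_two_lattice intro!: ord_mor_const)

lemma u_mor_N_lattice:
  assumes "\<alpha> \<in> u_mor Y N_str" "\<beta> \<in> u_mor Y N_str" and Y: "u_closed Y (pts Y)"
  shows "(\<lambda>y\<in>pts Y. join N_alg (\<alpha> y) (\<beta> y)) \<in> u_mor Y N_str"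
    and "(\<lambda>y\<in>pts Y. meet N_alg (\<alpha> y) (\<beta> y)) \<in> u_mor Y N_str"
    and "(\<lambda>y\<in>pts Y. ockop N_alg l (\<alpha> y)) \<in> u_mor Y N_str"
proof -
  have c: "continuous_map (topo Y) (topo N_str) \<alpha>" "continuous_map (topo Y) (topo N_str) \<beta>"
    using assms by (auto simp: u_mor_def ord_mor_def)
  have uY: "uop Y l y \<in> pts Y" if "y \<in> pts Y" for l y
    using Y that by (simp add: u_closed_iff)
  have join: "continuous_map (topo Y) (topo N_str) (\<lambda>y\<in>pts Y. join N_alg (\<alpha> y) (\<beta> y))"
    by (rule continuous_map_eq[OF continuous_map_N_algebra(1)[OF c]]) simp
  have meet: "continuous_map (topo Y) (topo N_str) (\<lambda>y\<in>pts Y. meet N_alg (\<alpha> y) (\<beta> y))"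
    by (rule continuous_map_eq[OF continuous_map_N_algebra(2)[OF c]]) simp
  have op: "continuous_map (topo Y) (topo N_str) (\<lambda>y\<in>pts Y. ockop N_alg l (\<alpha> y))"
    by (rule continuous_map_eq[OF continuous_map_N_unary(1)[OF c(1)]]) simp
  have mono: "leq N_str (join N_alg a b) (join N_alg a' b')" "leq N_str (meet N_alg a b) (meet N_alg a' b')"
    if "leq N_str a a'" "leq N_str b b'" for a b a' b'
  proof -
    have "signed s a \<longrightarrow> signed s a'" "signed s b \<longrightarrow> signed s b'" for s
      using that by (simp_all add: leq_N_iff)
    then have "signed s (join N_alg a b) \<longrightarrow> signed s (join N_alg a' b')"
      "signed s (meet N_alg a b) \<longrightarrow> signed s (meet N_alg a' b')" for s
      unfolding signed_def N_alg_simps by meson+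
    then show "leq N_str (join N_alg a b) (join N_alg a' b')" "leq N_str (meet N_alg a b) (meet N_alg a' b')"
      unfolding leq_N_iff by blast+
  qed
  have antitone: "leq N_str (ockop N_alg l a) (ockop N_alg l a')" if "leq N_str a a'" for a a'
  proof -
    have "signed (s @ [l]) a \<longrightarrow> signed (s @ [l]) a'" for s
      using that by (simp add: leq_N_iff)
    then show ?thesis unfolding leq_N_iff by (simp add: signed_def)
  qed
  show "(\<lambda>y\<in>pts Y. join N_alg (\<alpha> y) (\<beta> y)) \<in> u_mor Y N_str"
    using assms join mono(1) by (simp add: u_mor_iff ord_mor_def uY pts_N_str Pi_iff del: N_str_simps(1))
  show "(\<lambda>y\<in>pts Y. meet N_alg (\<alpha> y) (\<beta> y)) \<in> u_mor Y N_str"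
    using assms meet mono(2) by (simp add: u_mor_iff ord_mor_def uY pts_N_str Pi_iff del: N_str_simps(1))
  show "(\<lambda>y\<in>pts Y. ockop N_alg l (\<alpha> y)) \<in> u_mor Y N_str"
    using assms op antitone by (simp add: u_mor_iff ord_mor_def uY pts_N_str Pi_iff del: N_str_simps(1))
qed

text \<open>The first letter acts first, because \<open>u\<^sub>1\<close> and \<open>u\<^sub>2\<close> on \<open>N\<close> add letters on the left.\<close>

definition word_u :: "'y uspace \<Rightarrow> word \<Rightarrow> 'y \<Rightarrow> 'y" where
  "word_u Y s = fold (uop Y) s"

lemma word_u_simps [simp]: "word_u Y [] y = y" "word_u Y (l # s) y = word_u Y s (uop Y l y)"
  by (simp_all add: word_u_def)

text \<open>The morphism into the alter ego that lies over a Priestley morphism \<open>\<psi>\<close>; the maps \<open>u\<^sub>1\<close>, \<open>u\<^sub>2\<close> do not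
  complement values, so in contrast to the lifting for algebras there is no sign.\<close>

definition lift_str :: "'y uspace \<Rightarrow> ('y \<Rightarrow> bool) \<Rightarrow> 'y \<Rightarrow> N" where
  "lift_str Y \<psi> = (\<lambda>y\<in>pts Y. \<lambda>s. \<psi> (word_u Y s y))"

text \<open>An intrinsic description of the structures to be represented: the duals of double Ockham algebras
  in the sense of restricted Priestley duality. The last condition is total order-disconnectedness,
  with the separating clopen up-set given by its characteristic morphism; it makes the order reflexive
  and transitive.\<close>

locale ockham_space =
  fixes Y :: "'y uspace"
  assumes compact: "compact_space (topo Y)"
    and uop_continuous: "continuous_map (topo Y) (topo Y) (uop Y l)"
    and uop_antitone: "x \<in> pts Y \<Longrightarrow> y \<in> pts Y \<Longrightarrow> leq Y x y \<Longrightarrow> leq Y (uop Y l y) (uop Y l x)"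
    and leq_antisym: "x \<in> pts Y \<Longrightarrow> y \<in> pts Y \<Longrightarrow> leq Y x y \<Longrightarrow> leq Y y x \<Longrightarrow> x = y"
    and separation: "x \<in> pts Y \<Longrightarrow> y \<in> pts Y \<Longrightarrow> \<not> leq Y x y \<Longrightarrow>
      \<exists>\<psi>\<in>ord_mor Y two_space. \<psi> x \<and> \<not> \<psi> y"
begin

lemma uop_closed [simp]: "y \<in> pts Y \<Longrightarrow> uop Y l y \<in> pts Y"
  using uop_continuous[of l] by (auto simp: continuous_map_def)

lemma u_closed: "u_closed Y (pts Y)"
  by (simp add: u_closed_iff)

lemma word_u_closed [simp]: "y \<in> pts Y \<Longrightarrow> word_u Y s y \<in> pts Y"
  by (induction s arbitrary: y) auto

lemma word_u_continuous: "continuous_map (topo Y) (topo Y) (word_u Y s)"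
proof (induction s)
  case Nil
  show ?case by (rule continuous_map_eq[OF continuous_map_id]) simp
next
  case (Cons l s)
  show ?case
    by (rule continuous_map_eq[OF continuous_map_compose[OF uop_continuous[of l] Cons.IH]]) simp
qed

lemma word_u_mono:
  assumes "x \<in> pts Y" "y \<in> pts Y" "leq Y x y"
  shows "if even (length s) then leq Y (word_u Y s x) (word_u Y s y)
         else leq Y (word_u Y s y) (word_u Y s x)"
  using assms
proof (induction s arbitrary: x y)
  case (Cons l s)
  have "leq Y (uop Y l y) (uop Y l x)" by (rule uop_antitone) (use Cons.prems in auto)
  with Cons.IH[of "uop Y l y" "uop Y l x"] Cons.prems show ?case by auto
qed simp

text \<open>Peeling off the first letter of \<open>s\<close> moves the point by one of \<open>u\<^sub>1\<close>, \<open>u\<^sub>2\<close>.\<close>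

lemma u_mor_N_determined:
  assumes \<alpha>: "\<alpha> \<in> u_mor Y N_str" and "y \<in> pts Y"
  shows "\<alpha> y s \<longleftrightarrow> omega (\<alpha> (word_u Y s y))"
  using \<open>y \<in> pts Y\<close>
proof (induction s arbitrary: y)
  case (Cons l s)
  have "\<alpha> (uop Y l y) s = \<alpha> y (l # s)" using \<alpha> Cons.prems by (simp add: u_mor_iff)
  with Cons show ?case by simp
qed (simp add: omega_def)

lemma u_mor_N_eqI:
  assumes "\<alpha> \<in> u_mor Y N_str" "\<beta> \<in> u_mor Y N_str"
    and "\<And>y. y \<in> pts Y \<Longrightarrow> omega (\<alpha> y) = omega (\<beta> y)"
  shows "\<alpha> = \<beta>"
proof (rule extensionalityI[of _ "pts Y"])
  show "\<alpha> \<in> extensional (pts Y)" "\<beta> \<in> extensional (pts Y)"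
    using assms by (auto simp: u_mor_def ord_mor_def PiE_def)
  show "\<alpha> y = \<beta> y" if "y \<in> pts Y" for y
    using u_mor_N_determined[OF assms(1) that] u_mor_N_determined[OF assms(2) that]
      assms(3)[OF word_u_closed[OF that]] by (intro ext) simp
qed

lemma omega_lift_str: "y \<in> pts Y \<Longrightarrow> omega (lift_str Y \<psi> y) = \<psi> y"
  by (simp add: lift_str_def omega_def)

text \<open>A word moves points monotonically or antitonically according to its parity, which is exactly how
  the order of \<open>N\<close> treats the coordinate at that word.\<close>

lemma lift_str_mor:
  assumes \<psi>: "\<psi> \<in> ord_mor Y two_space"
  shows "lift_str Y \<psi> \<in> u_mor Y N_str"
proof -
  have "continuous_map (topo Y) two_top (\<lambda>y. lift_str Y \<psi> y s)" for s
  proof (rule continuous_map_eq)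
    show "continuous_map (topo Y) two_top (\<psi> \<circ> word_u Y s)"
      by (rule continuous_map_compose[OF word_u_continuous]) (use \<psi> in \<open>simp add: ord_mor_def\<close>)
  qed (simp add: lift_str_def)
  then have "continuous_map (topo Y) (topo N_str) (lift_str Y \<psi>)"
    by (simp only: continuous_map_N_iff) simp
  moreover have "leq N_str (lift_str Y \<psi> x) (lift_str Y \<psi> y)"
    if xy: "x \<in> pts Y" "y \<in> pts Y" "leq Y x y" for x y
  proof -
    have mono: "\<psi> v \<longrightarrow> \<psi> w" if "v \<in> pts Y" "w \<in> pts Y" "leq Y v w" for v w
      using \<psi> that by (simp add: ord_mor_def)
    have "signed s (lift_str Y \<psi> x) \<longrightarrow> signed s (lift_str Y \<psi> y)" for s
      using word_u_mono[OF xy, of s] xy mono[of "word_u Y s x" "word_u Y s y"]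
        mono[of "word_u Y s y" "word_u Y s x"]
      by (auto simp: signed_def lift_str_def)
    then show ?thesis by (simp add: leq_N_iff)
  qed
  ultimately show ?thesis
    by (simp add: u_mor_iff ord_mor_def lift_str_def PiE_iff pts_N_str del: N_str_simps(1))
qed

lemma compose_omega_u_mor:
  assumes "\<alpha> \<in> u_mor Y N_str"
  shows "(\<lambda>y\<in>pts Y. omega (\<alpha> y)) \<in> ord_mor Y two_space"
proof -
  have "continuous_map (topo Y) two_top (omega \<circ> \<alpha>)"
    by (rule continuous_map_compose[of _ "topo N_str"])
      (use assms omega_mor(2) in \<open>simp_all add: u_mor_def ord_mor_def\<close>)
  then have "continuous_map (topo Y) two_top (\<lambda>y\<in>pts Y. omega (\<alpha> y))"
    by (rule continuous_map_eq) simp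
  moreover have "omega (\<alpha> x) \<longrightarrow> omega (\<alpha> y)" if "x \<in> pts Y" "y \<in> pts Y" "leq Y x y" for x y
  proof -
    have "leq N_str (\<alpha> x) (\<alpha> y)" using assms that by (simp add: u_mor_def ord_mor_def)
    then show ?thesis using omega_mor(2) by (simp add: ord_mor_def)
  qed
  ultimately show ?thesis
    by (simp add: ord_mor_def)
qed

lemma double_Ockham_E: "double_Ockham (E_obj Y)"
proof -
  have const: "(\<lambda>y\<in>pts Y. \<lambda>s. c) \<in> u_mor Y N_str" for c
    using ord_mor_const[of "\<lambda>s. c" N_str Y] by (simp add: u_mor_iff leq_N_iff)
  have "bounded_distributive_lattice (E_obj Y)"
  proof (rule bdl_subalgebra[OF bdl_power[of "lat_flat N_alg" "pts Y"]])
    show "bounded_distributive_lattice (lat_flat N_alg)" using bdl_N_two(1) by simp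
    show "u_mor Y N_str \<subseteq> carrier (lat_power (pts Y) (lat_flat N_alg))"
      by (auto simp: u_mor_def ord_mor_def lat_power_def)
  qed (auto simp: E_obj_simps fun_eq_iff lat_power_def const u_mor_N_lattice[OF _ _ u_closed, simplified])
  moreover have "dual_endomorphism (E_obj Y) (ockop (E_obj Y) l)" for l
    using u_mor_N_lattice(3)[OF _ _ u_closed]
    by (auto simp: dual_endomorphism_def E_obj_simps fun_eq_iff u_mor_N_lattice[OF _ _ u_closed, simplified])
  ultimately show ?thesis by (simp add: double_Ockham_iff)
qed

text \<open>The lattice operations on both sides are computed pointwise and \<open>\<omega>\<close> preserves them; bijectivity is
  unique lifting along \<open>\<omega>\<close>.\<close>

lemma lat_iso_Psi: "lat_iso (lat_flat (E_obj Y)) (K_obj (ord_flat Y)) (Psi Y)"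
proof -
  have Psi: "Psi Y \<alpha> = (\<lambda>y\<in>pts Y. omega (\<alpha> y))" if "\<alpha> \<in> u_mor Y N_str" for \<alpha>
    using that by (simp add: Psi_def E_obj_simps compose_def)
  interpret E: ockham_algebra "E_obj Y" by unfold_locales (rule double_Ockham_E)
  have Psi_hom: "Psi Y \<in> lat_hom (E_obj Y) (K_obj (ord_flat Y))"
    unfolding lat_hom_def mem_Collect_eq
  proof (intro conjI ballI)
    show "Psi Y \<in> carrier (E_obj Y) \<rightarrow>\<^sub>E carrier (K_obj (ord_flat Y))"
      by (auto simp: E_obj_simps K_obj_simps Psi compose_omega_u_mor) (simp add: Psi_def E_obj_simps)
    fix \<alpha> \<beta> assume "\<alpha> \<in> carrier (E_obj Y)" "\<beta> \<in> carrier (E_obj Y)"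
    then have \<alpha>\<beta>: "\<alpha> \<in> u_mor Y N_str" "\<beta> \<in> u_mor Y N_str"
      "join (E_obj Y) \<alpha> \<beta> \<in> u_mor Y N_str" "meet (E_obj Y) \<alpha> \<beta> \<in> u_mor Y N_str"
      using E.closed(3,4)[of \<alpha> \<beta>] by (simp_all only: E_obj_simps(1))
    then show "Psi Y (join (E_obj Y) \<alpha> \<beta>) = join (K_obj (ord_flat Y)) (Psi Y \<alpha>) (Psi Y \<beta>)"
      "Psi Y (meet (E_obj Y) \<alpha> \<beta>) = meet (K_obj (ord_flat Y)) (Psi Y \<alpha>) (Psi Y \<beta>)"
      unfolding \<alpha>\<beta>[THEN Psi] by (auto simp: E_obj_simps K_obj_simps omega_def fun_eq_iff)
  next
    have z: "lzero (E_obj Y) \<in> u_mor Y N_str" "lone (E_obj Y) \<in> u_mor Y N_str"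
      using E.closed(1,2) by (simp_all only: E_obj_simps(1))
    show "Psi Y (lzero (E_obj Y)) = lzero (K_obj (ord_flat Y))"
      "Psi Y (lone (E_obj Y)) = lone (K_obj (ord_flat Y))"
      unfolding z[THEN Psi] by (auto simp: E_obj_simps K_obj_simps omega_def fun_eq_iff)
  qed
  have "inj_on (Psi Y) (u_mor Y N_str)"
  proof (rule inj_onI)
    fix \<alpha> \<beta> assume \<alpha>\<beta>: "\<alpha> \<in> u_mor Y N_str" "\<beta> \<in> u_mor Y N_str" and eq: "Psi Y \<alpha> = Psi Y \<beta>"
    show "\<alpha> = \<beta>"
    proof (rule u_mor_N_eqI[OF \<alpha>\<beta>])
      show "omega (\<alpha> y) = omega (\<beta> y)" if "y \<in> pts Y" for y
        using fun_cong[OF eq, of y] \<alpha>\<beta> that by (simp add: Psi)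
    qed
  qed
  moreover have "\<psi> \<in> Psi Y ` u_mor Y N_str" if "\<psi> \<in> ord_mor Y two_space" for \<psi>
  proof -
    have "\<psi> = Psi Y (lift_str Y \<psi>)"
      using that by (intro extensionalityI[of _ "pts Y"])
        (auto simp: Psi lift_str_mor omega_lift_str ord_mor_def PiE_iff)
    then show ?thesis using lift_str_mor[OF that] by (rule image_eqI)
  qed
  ultimately have "bij_betw (Psi Y) (carrier (lat_flat (E_obj Y))) (carrier (K_obj (ord_flat Y)))"
    using compose_omega_u_mor by (auto simp: bij_betw_def E_obj_simps(1) K_obj_simps(1) Psi)
  then show ?thesis
    using E.bdl Psi_hom by (intro lat_isoI_bij) simp_all
qed

end

section \<open>Closed substructures of powers of the alter ego\<close>

lemma leq_N_uop: "leq N_str a b \<Longrightarrow> leq N_str (uop N_str l b) (uop N_str l a)"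
proof -
  assume "leq N_str a b"
  then have "signed (l # s) a \<longrightarrow> signed (l # s) b" for s by (simp add: leq_N_iff)
  then show ?thesis unfolding leq_N_iff by (auto simp: signed_def)
qed

lemma leq_N_refl: "leq N_str a a"
  by (simp add: leq_N_iff)

text \<open>Membership of the class in coordinates, with the inverse of the isomorphism kept as
  a witness.\<close>

lemma in_Y_representation:
  assumes "in_Y TYPE('i) (Y :: 'y uspace)"
  shows "\<exists>(I :: 'i set) S h k. I \<noteq> {} \<and>
    closedin (product_topology (\<lambda>_. topo N_str) I) S \<and>
    homeomorphic_maps (topo Y) (subtopology (product_topology (\<lambda>_. topo N_str) I) S) h k \<and>
    (\<forall>x\<in>pts Y. \<forall>y\<in>pts Y. leq Y x y \<longleftrightarrow> (\<forall>i\<in>I. leq N_str (h x i) (h y i))) \<and>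
    (\<forall>l. \<forall>y\<in>pts Y. uop Y l y \<in> pts Y \<and> h (uop Y l y) = (\<lambda>i\<in>I. uop N_str l (h y i)))"
proof -
  obtain I :: "'i set" and S h where Y: "u_closed Y (pts Y)" and I: "I \<noteq> {}"
    and S: "closed_substructure (u_power I N_str) S"
    and iso: "u_iso Y (on_subset (u_power I N_str) S) h"
    using assms unfolding in_Y_def by auto
  let ?P = "product_topology (\<lambda>_. topo N_str) I"
  let ?Q = "on_subset (u_power I N_str) S"
  have clo: "closedin ?P S"
    using S by (simp add: closed_substructure_def del: N_str_simps)
  obtain k where h: "h \<in> u_mor Y ?Q" and k: "k \<in> u_mor ?Q Y"
    and kh: "\<And>x. x \<in> pts Y \<Longrightarrow> k (h x) = x" and hk: "\<And>v. v \<in> pts ?Q \<Longrightarrow> h (k v) = v"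
    using iso unfolding u_iso_def by auto
  have hom: "homeomorphic_maps (topo Y) (subtopology ?P S) h k"
    using h k kh hk by (simp add: homeomorphic_maps_def u_mor_def ord_mor_def del: N_str_simps)
  have ord: "leq Y x y \<longleftrightarrow> (\<forall>i\<in>I. leq N_str (h x i) (h y i))" if xy: "x \<in> pts Y" "y \<in> pts Y" for x y
  proof -
    have "h x \<in> pts ?Q" "h y \<in> pts ?Q" using h xy by (auto simp: u_mor_def ord_mor_def)
    then have "leq Y x y \<longleftrightarrow> leq ?Q (h x) (h y)"
      using h k kh xy unfolding u_mor_def ord_mor_def by (metis (no_types, lifting) mem_Collect_eq)
    then show ?thesis by simp
  qed
  have ops: "uop Y l y \<in> pts Y" "h (uop Y l y) = (\<lambda>i\<in>I. uop N_str l (h y i))"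
    if "y \<in> pts Y" for l y
    using Y h that by (simp_all add: u_closed_iff u_mor_iff)
  show ?thesis
    by (intro exI conjI ballI allI) (fact I clo hom ord ops)+
qed

text \<open>Each condition holds in \<open>N\<close> and is inherited by powers and closed substructures. The separating
  morphisms are the signed coordinates.\<close>

lemma in_Y_ockham_space:
  assumes "in_Y TYPE('i) (Y :: 'y uspace)"
  shows "ockham_space Y"
proof -
  obtain I :: "'i set" and S h k where
    clo: "closedin (product_topology (\<lambda>_. topo N_str) I) S" and
    hk: "homeomorphic_maps (topo Y) (subtopology (product_topology (\<lambda>_. topo N_str) I) S) h k" and
    leq: "\<And>x y. x \<in> pts Y \<Longrightarrow> y \<in> pts Y \<Longrightarrow> leq Y x y \<longleftrightarrow> (\<forall>i\<in>I. leq N_str (h x i) (h y i))" and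
    u: "\<And>l y. y \<in> pts Y \<Longrightarrow> uop Y l y \<in> pts Y \<and> h (uop Y l y) = (\<lambda>i\<in>I. uop N_str l (h y i))"
    using in_Y_representation[OF assms] by metis
  let ?P = "product_topology (\<lambda>_. topo N_str) I"
  have h: "continuous_map (topo Y) (subtopology ?P S) h" and k: "continuous_map (subtopology ?P S) (topo Y) k"
    and kh: "\<And>y. y \<in> pts Y \<Longrightarrow> k (h y) = y"
    using hk by (simp_all add: homeomorphic_maps_def del: N_str_simps)
  have hP: "continuous_map (topo Y) ?P h" and hS: "h \<in> pts Y \<rightarrow> S"
    using h by (auto simp: continuous_map_in_subtopology simp del: N_str_simps)
  have coord: "continuous_map (topo Y) (topo N_str) (\<lambda>y. h y i)" if "i \<in> I" for i
    using hP that by (simp add: continuous_map_power_iff del: N_str_simps)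
  show ?thesis
  proof
    have "compact_space (subtopology ?P S)"
      by (intro compact_space_subtopology closedin_compact_space clo compact_Hausdorff_power)
    then show "compact_space (topo Y)"
      using homeomorphic_compact_space hk unfolding homeomorphic_space_def by blast
  next
    fix l
    have "continuous_map (topo Y) ?P (\<lambda>y. \<lambda>i\<in>I. uop N_str l (h y i))"
      by (simp add: continuous_map_power_iff coord continuous_map_N_unary(2) del: N_str_simps)
    then have "continuous_map (topo Y) ?P (\<lambda>y. h (uop Y l y))"
      by (rule continuous_map_eq) (simp add: u del: N_str_simps)
    then have "continuous_map (topo Y) (subtopology ?P S) (\<lambda>y. h (uop Y l y))"
      by (rule continuous_map_into_subtopology) (use u hS in auto)
    moreover have "k (h (uop Y l y)) = uop Y l y" if "y \<in> pts Y" for y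
      by (rule kh) (use u that in blast)
    ultimately show "continuous_map (topo Y) (topo Y) (uop Y l)"
      by (intro continuous_map_eq[OF continuous_map_compose[OF _ k]]) (simp_all only: comp_apply)
  next
    show "leq Y (uop Y l y) (uop Y l x)" if "x \<in> pts Y" "y \<in> pts Y" "leq Y x y" for l x y
      using that u leq leq_N_uop by (simp del: N_str_simps)
  next
    show "x = y" if xy: "x \<in> pts Y" "y \<in> pts Y" "leq Y x y" "leq Y y x" for x y
    proof -
      have "h v \<in> extensional I" if "v \<in> pts Y" for v
        using hP that by (auto simp: continuous_map_power_iff simp del: N_str_simps)
      then have "h x = h y"
        using xy leq N_eqI by (intro extensionalityI[of _ I]) auto
      then show ?thesis using kh xy(1,2) by metis
    qed
  next
    show "\<exists>\<psi>\<in>ord_mor Y two_space. \<psi> x \<and> \<not> \<psi> y"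
      if xy: "x \<in> pts Y" "y \<in> pts Y" "\<not> leq Y x y" for x y
    proof -
      obtain i s where i: "i \<in> I" and s: "signed s (h x i)" "\<not> signed s (h y i)"
        using xy leq leq_N_iff by auto
      have "continuous_map (topo Y) two_top (\<lambda>y. h y i s)"
        using coord[OF i] by (simp only: continuous_map_N_iff)
      then have "continuous_map (topo Y) two_top (\<lambda>y. signed s (h y i))"
        unfolding signed_def by (rule continuous_map_two_top_neq_const)
      then have "continuous_map (topo Y) two_top (\<lambda>y\<in>pts Y. signed s (h y i))"
        by (rule continuous_map_eq) simp
      moreover have "signed s (h v i) \<longrightarrow> signed s (h w i)" if "v \<in> pts Y" "w \<in> pts Y" "leq Y v w" for v w
        using that leq i leq_N_iff by blast
      ultimately have "(\<lambda>y\<in>pts Y. signed s (h y i)) \<in> ord_mor Y two_space"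
        by (simp add: ord_mor_def)
      then show ?thesis using s xy by (intro bexI) auto
    qed
  qed
qed

text \<open>The signed coordinates, indexed by pairs of a factor of the power and a word, embed the structure
  into a power of \<open>2\<close>; compactness makes the image closed.\<close>

lemma in_Y_in_P:
  assumes "in_Y TYPE('i) (Y :: 'y uspace)"
  shows "in_P TYPE('i \<times> word) (ord_flat Y)"
proof -
  interpret ockham_space Y by (rule in_Y_ockham_space[OF assms])
  obtain I :: "'i set" and S h k where I: "I \<noteq> {}" and
    hk: "homeomorphic_maps (topo Y) (subtopology (product_topology (\<lambda>_. topo N_str) I) S) h k" and
    leq: "\<And>x y. x \<in> pts Y \<Longrightarrow> y \<in> pts Y \<Longrightarrow> leq Y x y \<longleftrightarrow> (\<forall>i\<in>I. leq N_str (h x i) (h y i))"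
    using in_Y_representation[OF assms] by metis
  have hP: "continuous_map (topo Y) (product_topology (\<lambda>_. topo N_str) I) h"
    using hk by (auto simp: homeomorphic_maps_def continuous_map_in_subtopology simp del: N_str_simps)
  define J where "J = I \<times> (UNIV :: word set)"
  let ?Q = "product_topology (\<lambda>_. two_top) J"
  define g where "g = (\<lambda>y\<in>pts Y. \<lambda>(i, s)\<in>J. signed s (h y i))"
  have "continuous_map (topo Y) two_top (\<lambda>y. signed s (h y i))" if "(i, s) \<in> J" for i s
  proof -
    have "continuous_map (topo Y) (topo N_str) (\<lambda>y. h y i)"
      using hP that by (simp add: J_def continuous_map_power_iff del: N_str_simps)
    then show ?thesis
      unfolding signed_def
      by (intro continuous_map_two_top_neq_const) (simp only: continuous_map_N_iff)
  qed
  then have "continuous_map (topo Y) ?Q (\<lambda>y. \<lambda>(i, s)\<in>J. signed s (h y i))"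
    by (auto simp: continuous_map_power_iff)
  then have g_cont: "continuous_map (topo Y) ?Q g"
    by (rule continuous_map_eq) (simp add: g_def)
  have "compactin ?Q (g ` pts Y)"
    using compact g_cont image_compactin unfolding compact_space_def by blast
  then have clo: "closedin ?Q (g ` pts Y)"
    by (rule compactin_imp_closedin[OF compact_Hausdorff_power(2)])
  have g_leq: "leq Y x y \<longleftrightarrow> (\<forall>j\<in>J. g x j \<longrightarrow> g y j)" if "x \<in> pts Y" "y \<in> pts Y" for x y
    using that by (auto simp: leq leq_N_iff g_def J_def)
  have "ord_iso Y (on_subset (ord_power J two_space) (g ` pts Y)) g"
  proof (rule ord_isoI_compact[OF compact])
    show "Hausdorff_space (topo (on_subset (ord_power J two_space) (g ` pts Y)))"
      by (simp add: Hausdorff_space_subtopology compact_Hausdorff_power)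
    show "g ` pts Y = pts (on_subset (ord_power J two_space) (g ` pts Y))"
      using closedin_subset[OF clo] by auto
    show "inj_on g (pts Y)"
    proof (rule inj_onI)
      fix x y assume xy: "x \<in> pts Y" "y \<in> pts Y" "g x = g y"
      then show "x = y" using leq_antisym g_leq by simp
    qed
    show "g \<in> ord_mor Y (on_subset (ord_power J two_space) (g ` pts Y))"
      using g_cont g_leq closedin_subset[OF clo]
      by (auto simp: ord_mor_def continuous_map_in_subtopology) (simp add: g_def)
  qed (simp add: g_leq)
  then have iso: "ord_iso (ord_flat Y) (on_subset (ord_power J two_space) (g ` pts Y)) g"
    by (simp add: ord_iso_def ord_mor_def)
  have "J \<noteq> {}" using I by (simp add: J_def)
  with iso clo show ?thesis
    unfolding in_P_def power_simps by blast
qed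

section \<open>The functors\<close>

lemma u_mor_compose:
  assumes f: "f \<in> u_mor X Y" and g: "g \<in> u_mor Y Z" and X: "u_closed X (pts X)"
  shows "compose (pts X) g f \<in> u_mor X Z"
proof -
  have f_pts: "f x \<in> pts Y" if "x \<in> pts X" for x
    using f that by (auto simp: u_mor_def ord_mor_def)
  have g_pts: "g y \<in> pts Z" if "y \<in> pts Y" for y
    using g that by (auto simp: u_mor_def ord_mor_def)
  have "continuous_map (topo X) (topo Z) (g \<circ> f)"
    by (rule continuous_map_compose[of _ "topo Y"]) (use f g in \<open>simp_all add: u_mor_def ord_mor_def\<close>)
  then have "continuous_map (topo X) (topo Z) (compose (pts X) g f)"
    by (rule continuous_map_eq) (simp add: compose_def)
  moreover have "compose (pts X) g f \<in> pts X \<rightarrow>\<^sub>E pts Z"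
    using f_pts g_pts by (simp add: compose_def)
  moreover have "leq Z (g (f x)) (g (f y))" if "x \<in> pts X" "y \<in> pts X" "leq X x y" for x y
    using f g f_pts that by (simp add: u_mor_def ord_mor_def)
  ultimately show ?thesis
    using f g f_pts X by (simp add: u_mor_iff ord_mor_def u_closed_iff compose_def)
qed

lemma ock_hom_compose:
  assumes A: "double_Ockham A" and f: "f \<in> ock_hom A B" and g: "g \<in> ock_hom B C"
  shows "compose (carrier A) g f \<in> ock_hom A C"
proof -
  interpret ockham_algebra A by unfold_locales (rule A)
  have "f a \<in> carrier B" if "a \<in> carrier A" for a
    using f that by (auto simp: ock_hom_def lat_hom_def)
  moreover have "g b \<in> carrier C" if "b \<in> carrier B" for b
    using g that by (auto simp: ock_hom_def lat_hom_def)
  ultimately show ?thesis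
    using f g by (simp add: ock_hom_iff lat_hom_def compose_def)
qed

lemma D_mor_u_mor:
  assumes A: "double_Ockham A" and B: "double_Ockham B" and h: "h \<in> ock_hom A B"
  shows "D_mor A B h \<in> u_mor (D_obj B) (D_obj A)"
proof -
  interpret A: ockham_algebra A by unfold_locales (rule A)
  interpret B: ockham_algebra B by unfold_locales (rule B)
  have hB: "h a \<in> carrier B" if "a \<in> carrier A" for a
    using h that by (auto simp: ock_hom_def lat_hom_def)
  have D: "D_mor A B h x = (\<lambda>a\<in>carrier A. x (h a))" if "x \<in> ock_hom B N_alg" for x
    using that by (simp add: D_mor_def D_obj_simps(2) compose_def)
  have hom: "D_mor A B h x \<in> ock_hom A N_alg" if "x \<in> ock_hom B N_alg" for x
    using ock_hom_compose[OF A h that] that by (simp add: D compose_def)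
  have "continuous_map (topo (D_obj B)) (product_topology (\<lambda>_. topo N_str) (carrier A))
      (\<lambda>x. \<lambda>a\<in>carrier A. x (h a))"
    using hB by (simp add: continuous_map_power_iff D_obj_simps(1) continuous_map_power_coordinate del: N_str_simps)
  then have "continuous_map (topo (D_obj B)) (product_topology (\<lambda>_. topo N_str) (carrier A)) (D_mor A B h)"
    by (rule continuous_map_eq) (simp add: D D_obj_simps(2))
  then have "continuous_map (topo (D_obj B)) (topo (D_obj A)) (D_mor A B h)"
    unfolding D_obj_simps(1)[of A]
    by (rule continuous_map_into_subtopology) (use hom in \<open>auto simp: D_obj_simps(2)\<close>)
  moreover have "D_mor A B h \<in> pts (D_obj B) \<rightarrow>\<^sub>E pts (D_obj A)"
    using hom by (simp add: D_obj_simps(2) PiE_iff) (simp add: D_mor_def D_obj_simps(2))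
  moreover have "leq (D_obj A) (D_mor A B h x) (D_mor A B h x')"
    if "x \<in> ock_hom B N_alg" "x' \<in> ock_hom B N_alg" "leq (D_obj B) x x'" for x x'
    using that hB by (simp add: D_obj_simps(3) D)
  moreover have "D_mor A B h (uop (D_obj B) l x) = uop (D_obj A) l (D_mor A B h x)"
    if x: "x \<in> ock_hom B N_alg" for l x
  proof -
    have "uop (D_obj B) l x \<in> ock_hom B N_alg" using B.u_closed_D x by (simp add: u_closed_iff)
    with x hB show ?thesis
      by (simp add: D_obj_simps(4) D del: N_str_simps cong: restrict_cong)
  qed
  ultimately show ?thesis
    by (simp add: u_mor_iff ord_mor_def D_obj_simps(2))
qed

lemma E_mor_ock_hom:
  assumes Y: "u_closed Y (pts Y)" and Z: "ockham_space Z" and h: "h \<in> u_mor Y Z"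
  shows "E_mor Y Z h \<in> ock_hom (E_obj Z) (E_obj Y)"
proof -
  interpret Z: ockham_space Z by (rule Z)
  interpret E: ockham_algebra "E_obj Z" by unfold_locales (rule Z.double_Ockham_E)
  have hZ: "h y \<in> pts Z" if "y \<in> pts Y" for y
    using h that by (auto simp: u_mor_def ord_mor_def)
  have Em: "E_mor Y Z h \<alpha> = (\<lambda>y\<in>pts Y. \<alpha> (h y))" if "\<alpha> \<in> carrier (E_obj Z)" for \<alpha>
    using that by (simp add: E_mor_def compose_def)
  have mor: "E_mor Y Z h \<alpha> \<in> u_mor Y N_str" if "\<alpha> \<in> carrier (E_obj Z)" for \<alpha>
    using u_mor_compose[OF h _ Y, of \<alpha> N_str] that by (simp add: E_mor_def E_obj_simps(1))
  have "E_mor Y Z h \<in> carrier (E_obj Z) \<rightarrow>\<^sub>E carrier (E_obj Y)"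
    using mor by (simp add: PiE_iff E_obj_simps(1)) (simp add: E_mor_def E_obj_simps(1))
  moreover have "E_mor Y Z h (join (E_obj Z) \<alpha> \<beta>) = join (E_obj Y) (E_mor Y Z h \<alpha>) (E_mor Y Z h \<beta>)"
    "E_mor Y Z h (meet (E_obj Z) \<alpha> \<beta>) = meet (E_obj Y) (E_mor Y Z h \<alpha>) (E_mor Y Z h \<beta>)"
    if "\<alpha> \<in> carrier (E_obj Z)" "\<beta> \<in> carrier (E_obj Z)" for \<alpha> \<beta>
    using that hZ by (simp_all add: Em) (simp_all add: E_obj_simps(2,3) cong: restrict_cong)
  moreover have "E_mor Y Z h (lzero (E_obj Z)) = lzero (E_obj Y)" "E_mor Y Z h (lone (E_obj Z)) = lone (E_obj Y)"
    using hZ by (simp_all add: Em) (simp_all add: E_obj_simps(4,5) cong: restrict_cong)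
  moreover have "E_mor Y Z h (ockop (E_obj Z) l \<alpha>) = ockop (E_obj Y) l (E_mor Y Z h \<alpha>)"
    if "\<alpha> \<in> carrier (E_obj Z)" for l \<alpha>
    using that hZ by (simp add: Em) (simp add: E_obj_simps(6) cong: restrict_cong)
  ultimately show ?thesis
    by (simp add: ock_hom_iff lat_hom_def)
qed

section \<open>The evaluation maps\<close>

lemma ock_isoI_bij:
  assumes A: "double_Ockham A" and h: "h \<in> ock_hom A B"
    and bij: "bij_betw h (carrier A) (carrier B)"
  shows "ock_iso A B h"
proof -
  interpret ockham_algebra A by unfold_locales (rule A)
  have "lat_iso A B h"
    using h by (intro lat_isoI_bij bdl bij) (simp add: ock_hom_def)
  then obtain k where k: "k \<in> lat_hom B A" "\<And>a. a \<in> carrier A \<Longrightarrow> k (h a) = a"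
    "\<And>b. b \<in> carrier B \<Longrightarrow> h (k b) = b"
    unfolding lat_iso_def by auto
  have "k (ockop B l b) = ockop A l (k b)" if "b \<in> carrier B" for l b
  proof -
    have kb: "k b \<in> carrier A" using k(1) that by (auto simp: lat_hom_def)
    then have "h (ockop A l (k b)) = ockop B l b" using h k(3)[OF that] by (simp add: ock_hom_iff)
    with k(2)[of "ockop A l (k b)"] kb show ?thesis by simp
  qed
  then have "k \<in> ock_hom B A" using k(1) by (simp add: ock_hom_iff)
  then show ?thesis unfolding ock_iso_def using h k by blast
qed

context ockham_algebra
begin

lemma eval_alg_apply: "a \<in> carrier A \<Longrightarrow> eval_alg A a = (\<lambda>x\<in>ock_hom A N_alg. x a)"
  by (simp add: eval_alg_def D_obj_simps(2))

lemma eval_alg_mor: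
  assumes a: "a \<in> carrier A"
  shows "eval_alg A a \<in> u_mor (D_obj A) N_str"
proof -
  have "continuous_map (topo (D_obj A)) (topo N_str) (\<lambda>x. x a)"
    unfolding D_obj_simps(1) by (rule continuous_map_power_coordinate[OF a])
  then have "continuous_map (topo (D_obj A)) (topo N_str) (eval_alg A a)"
    by (rule continuous_map_eq) (simp add: eval_alg_apply[OF a] D_obj_simps(2))
  moreover have "uop (D_obj A) l x \<in> ock_hom A N_alg" if "x \<in> ock_hom A N_alg" for l x
    using u_closed_D that by (simp add: u_closed_iff)
  moreover have "uop (D_obj A) l x a = uop N_str l (x a)" for l x
    using a by (simp add: D_obj_simps(4) del: N_str_simps)
  ultimately show ?thesis
    using a by (simp add: u_mor_iff ord_mor_def eval_alg_apply[OF a] D_obj_simps(2,3) pts_N_str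
        del: N_str_simps)
qed

lemma eval_alg_hom: "eval_alg A \<in> ock_hom A (E_obj (D_obj A))"
proof -
  have N: "x (join A a b) = join N_alg (x a) (x b)" "x (meet A a b) = meet N_alg (x a) (x b)"
    if "x \<in> ock_hom A N_alg" "a \<in> carrier A" "b \<in> carrier A" for x a b
    using that by (simp_all only: ock_hom_iff lat_hom_def mem_Collect_eq)
  have N_op: "x (ockop A l a) = ockop N_alg l (x a)"
    if "x \<in> ock_hom A N_alg" "a \<in> carrier A" for x a l
    using that by (simp only: ock_hom_iff)
  have N_bounds: "x (lzero A) = lzero N_alg" "x (lone A) = lone N_alg"
    if "x \<in> ock_hom A N_alg" for x
    using that by (simp_all only: ock_hom_iff lat_hom_def mem_Collect_eq)
  have "eval_alg A \<in> carrier A \<rightarrow>\<^sub>E carrier (E_obj (D_obj A))"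
    using eval_alg_mor by (simp add: PiE_iff E_obj_simps(1)) (simp add: eval_alg_def)
  moreover have "eval_alg A (join A a b) = join (E_obj (D_obj A)) (eval_alg A a) (eval_alg A b)"
    "eval_alg A (meet A a b) = meet (E_obj (D_obj A)) (eval_alg A a) (eval_alg A b)"
    "eval_alg A (ockop A l a) = ockop (E_obj (D_obj A)) l (eval_alg A a)"
    if "a \<in> carrier A" "b \<in> carrier A" for a b l
    using that N N_op by (simp_all add: eval_alg_apply E_obj_simps(2,3,6) D_obj_simps(2)
        del: N_alg_simps cong: restrict_cong)
  moreover have "eval_alg A (lzero A) = lzero (E_obj (D_obj A))" "eval_alg A (lone A) = lone (E_obj (D_obj A))"
    using N_bounds by (simp_all add: eval_alg_apply E_obj_simps(4,5) D_obj_simps(2)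
        del: N_alg_simps cong: restrict_cong)
  ultimately show ?thesis
    by (simp add: ock_hom_iff lat_hom_def)
qed

text \<open>Elements that agree under evaluation agree under all lattice homomorphisms into \<open>2\<close>, since these
  lift to \<open>N\<close>.\<close>

lemma eval_alg_inj: "inj_on (eval_alg A) (carrier A)"
proof (rule inj_onI)
  fix a b assume ab: "a \<in> carrier A" "b \<in> carrier A" and eq: "eval_alg A a = eval_alg A b"
  show "a = b"
  proof (rule lat_homs_separate_points[OF ab])
    fix \<phi> assume "\<phi> \<in> lat_hom A two_lat"
    then have "lift_alg A \<phi> a = lift_alg A \<phi> b"
      using fun_cong[OF eq, of "lift_alg A \<phi>"] ab by (simp add: eval_alg_apply lift_alg_hom)
    then show "\<phi> a = \<phi> b" using ab omega_lift_alg by metis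
  qed
qed

text \<open>The sets \<open>W a\<close> of points at which \<open>a\<close> has value \<open>1\<close> form a ring of clopen sets, and two
  points not related by the order are told apart by some \<open>W a\<close>. Hence the clopen up-set that
  \<open>\<omega> \<circ> \<alpha>\<close> defines is itself some \<open>W a\<close>, and \<open>\<alpha>\<close> is determined by it.\<close>

lemma eval_alg_surj:
  assumes \<alpha>: "\<alpha> \<in> u_mor (D_obj A) N_str"
  shows "\<alpha> \<in> eval_alg A ` carrier A"
proof -
  interpret D: ockham_space "D_obj A" by (rule in_Y_ockham_space[OF in_Y_D])
  let ?X = "topo (D_obj A)"
  define W where "W a = {x \<in> ock_hom A N_alg. omega (x a)}" for a
  have W_ops: "W (join A a b) = W a \<union> W b" "W (meet A a b) = W a \<inter> W b"
    if "a \<in> carrier A" "b \<in> carrier A" for a b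
    using that by (auto simp: W_def ock_hom_iff lat_hom_def omega_def)
  have W_bounds: "W (lzero A) = {}" "W (lone A) = ock_hom A N_alg"
    by (auto simp: W_def ock_hom_iff lat_hom_def omega_def)
  have omega_clopen: "openin ?X {x \<in> ock_hom A N_alg. omega (\<beta> x)} \<and>
      closedin ?X {x \<in> ock_hom A N_alg. omega (\<beta> x)} \<and>
      closedin ?X {x \<in> ock_hom A N_alg. \<not> omega (\<beta> x)}"
    if "\<beta> \<in> u_mor (D_obj A) N_str" for \<beta>
  proof -
    have "continuous_map ?X two_top (\<lambda>y\<in>pts (D_obj A). omega (\<beta> y))"
      using D.compose_omega_u_mor[OF that] by (simp add: ord_mor_def)
    then have "continuous_map ?X two_top (\<lambda>y. omega (\<beta> y))"
      by (rule continuous_map_eq) simp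
    from clopen_preimage_two_top[OF this] show ?thesis unfolding D_obj_simps(2) by simp
  qed
  have "\<exists>V\<in>W ` carrier A. {x \<in> ock_hom A N_alg. omega (\<alpha> x)} \<subseteq> V \<and>
      V \<inter> {x \<in> ock_hom A N_alg. \<not> omega (\<alpha> x)} = {}"
  proof (rule ring_of_clopens_separates_closed_sets[OF D.compact])
    show "openin ?X V \<and> closedin ?X V" if V: "V \<in> W ` carrier A" for V
    proof -
      obtain a where a: "a \<in> carrier A" "V = W a" using V by auto
      have "W a = {x \<in> ock_hom A N_alg. omega (eval_alg A a x)}"
        using a by (auto simp: W_def eval_alg_apply)
      with omega_clopen[OF eval_alg_mor[OF a(1)]] a(2) show ?thesis by simp
    qed
    show "{} \<in> W ` carrier A" "pts (D_obj A) \<in> W ` carrier A"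
      unfolding D_obj_simps(2) using W_bounds closed(1,2) by (metis imageI)+
    show "V \<inter> V' \<in> W ` carrier A \<and> V \<union> V' \<in> W ` carrier A"
      if V: "V \<in> W ` carrier A" "V' \<in> W ` carrier A" for V V'
    proof -
      obtain a a' where "a \<in> carrier A" "V = W a" "a' \<in> carrier A" "V' = W a'"
        using V by auto
      then show ?thesis
        using W_ops[of a a'] imageI[OF closed(3)[of a a'], of W] imageI[OF closed(4)[of a a'], of W] by simp
    qed
    show "\<exists>V\<in>W ` carrier A. x \<in> V \<and> y \<notin> V"
      if "x \<in> {x \<in> ock_hom A N_alg. omega (\<alpha> x)}" "y \<in> {x \<in> ock_hom A N_alg. \<not> omega (\<alpha> x)}" for x y
    proof -
      have xy: "x \<in> ock_hom A N_alg" "y \<in> ock_hom A N_alg" "omega (\<alpha> x)" "\<not> omega (\<alpha> y)"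
        using that by simp_all
      have "\<not> leq (D_obj A) x y"
      proof
        assume "leq (D_obj A) x y"
        then show False
          using D.compose_omega_u_mor[OF \<alpha>] xy by (simp add: ord_mor_def D_obj_simps(2))
      qed
      then obtain a where "a \<in> carrier A" "omega (x a)" "\<not> omega (y a)"
        using leq_D_iff xy(1,2) by auto
      then show ?thesis using xy(1) by (intro bexI[of _ "W a"]) (auto simp: W_def)
    qed
  qed (use omega_clopen[OF \<alpha>] in simp_all)
  then obtain a where a: "a \<in> carrier A" and Wa: "{x \<in> ock_hom A N_alg. omega (\<alpha> x)} \<subseteq> W a"
    "W a \<inter> {x \<in> ock_hom A N_alg. \<not> omega (\<alpha> x)} = {}"
    by auto
  have "\<alpha> = eval_alg A a"
  proof (rule D.u_mor_N_eqI[OF \<alpha> eval_alg_mor[OF a]])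
    show "omega (\<alpha> x) = omega (eval_alg A a x)" if "x \<in> pts (D_obj A)" for x
      using that Wa unfolding D_obj_simps(2) by (auto simp: W_def eval_alg_apply[OF a])
  qed
  with a show ?thesis by blast
qed

lemma eval_alg_iso: "ock_iso A (E_obj (D_obj A)) (eval_alg A)"
proof (rule ock_isoI_bij[OF dO eval_alg_hom])
  show "bij_betw (eval_alg A) (carrier A) (carrier (E_obj (D_obj A)))"
    using eval_alg_inj eval_alg_mor eval_alg_surj
    by (auto simp: bij_betw_def E_obj_simps(1))
qed

end

context ockham_space
begin

lemma eval_str_apply: "y \<in> pts Y \<Longrightarrow> eval_str Y y = (\<lambda>\<alpha>\<in>u_mor Y N_str. \<alpha> y)"
  by (simp add: eval_str_def E_obj_simps(1))

lemma eval_str_hom: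
  assumes y: "y \<in> pts Y"
  shows "eval_str Y y \<in> ock_hom (E_obj Y) N_alg"
proof -
  interpret E: ockham_algebra "E_obj Y" by unfold_locales (rule double_Ockham_E)
  have ev: "eval_str Y y \<alpha> = \<alpha> y" if "\<alpha> \<in> carrier (E_obj Y)" for \<alpha>
    using that by (simp add: eval_str_apply[OF y] E_obj_simps(1))
  have "eval_str Y y \<in> carrier (E_obj Y) \<rightarrow>\<^sub>E carrier N_alg"
    by (simp add: eval_str_apply[OF y] E_obj_simps(1))
  then show ?thesis
    unfolding ock_hom_iff lat_hom_def
    by (simp add: ev del: N_alg_simps) (simp add: E_obj_simps(2-) y del: N_alg_simps)
qed

text \<open>A point that evaluates like \<open>x\<close> must lie in every set \<open>C \<alpha> \<beta>\<close>, where \<open>\<omega> \<circ> x\<close> takes \<open>\<alpha>\<close> to \<open>1\<close> and \<open>\<beta>\<close> to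
  \<open>0\<close>. None of these closed sets is empty, for otherwise \<open>\<alpha> \<le> \<beta>\<close>; meets of the \<open>\<alpha>\<close> and joins of the \<open>\<beta>\<close>
  make them a directed family, so compactness yields the point. Using pairs avoids finite meets
  and joins altogether.\<close>

lemma eval_str_surj:
  assumes x: "x \<in> ock_hom (E_obj Y) N_alg"
  shows "\<exists>y\<in>pts Y. x = eval_str Y y"
proof -
  interpret E: ockham_algebra "E_obj Y" by unfold_locales (rule double_Ockham_E)
  define \<phi> where "\<phi> \<alpha> = omega (x \<alpha>)" for \<alpha>
  have \<phi>: "\<phi> (join (E_obj Y) \<alpha> \<beta>) = (\<phi> \<alpha> \<or> \<phi> \<beta>)" "\<phi> (meet (E_obj Y) \<alpha> \<beta>) = (\<phi> \<alpha> \<and> \<phi> \<beta>)"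
    if "\<alpha> \<in> u_mor Y N_str" "\<beta> \<in> u_mor Y N_str" for \<alpha> \<beta>
    using x that by (simp_all add: \<phi>_def ock_hom_iff lat_hom_def omega_def E_obj_simps(1))
  have \<phi>_bounds: "\<not> \<phi> (lzero (E_obj Y))" "\<phi> (lone (E_obj Y))"
    using x by (simp_all add: \<phi>_def ock_hom_iff lat_hom_def omega_def)
  have E_closed: "lzero (E_obj Y) \<in> u_mor Y N_str" "lone (E_obj Y) \<in> u_mor Y N_str"
    "\<And>\<alpha> \<beta>. \<alpha> \<in> u_mor Y N_str \<Longrightarrow> \<beta> \<in> u_mor Y N_str \<Longrightarrow> join (E_obj Y) \<alpha> \<beta> \<in> u_mor Y N_str"
    "\<And>\<alpha> \<beta>. \<alpha> \<in> u_mor Y N_str \<Longrightarrow> \<beta> \<in> u_mor Y N_str \<Longrightarrow> meet (E_obj Y) \<alpha> \<beta> \<in> u_mor Y N_str"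
    using E.closed unfolding E_obj_simps(1) by auto
  have omega_ops: "omega (join (E_obj Y) \<alpha> \<beta> y) = (omega (\<alpha> y) \<or> omega (\<beta> y))"
    "omega (meet (E_obj Y) \<alpha> \<beta> y) = (omega (\<alpha> y) \<and> omega (\<beta> y))"
    "\<not> omega (lzero (E_obj Y) y)" "omega (lone (E_obj Y) y)"
    if "y \<in> pts Y" for \<alpha> \<beta> y
    using that by (simp_all add: E_obj_simps(2-5) omega_def)
  define C where "C \<alpha> \<beta> = {y \<in> pts Y. omega (\<alpha> y) \<and> \<not> omega (\<beta> y)}" for \<alpha> \<beta>
  let ?M = "u_mor Y N_str"
  let ?\<C> = "{C \<alpha> \<beta> |\<alpha> \<beta>. \<alpha> \<in> ?M \<and> \<beta> \<in> ?M \<and> \<phi> \<alpha> \<and> \<not> \<phi> \<beta>}"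
  have in_C: "C \<alpha> \<beta> \<in> ?\<C>" if "\<alpha> \<in> ?M" "\<beta> \<in> ?M" "\<phi> \<alpha>" "\<not> \<phi> \<beta>" for \<alpha> \<beta>
    using that by auto
  have "\<Inter>?\<C> \<noteq> {}"
  proof (rule compact_space_directed_family[OF compact])
    show "?\<C> \<noteq> {}" using in_C[OF E_closed(2,1) \<phi>_bounds(2,1)] by (metis empty_iff)
  next
    fix B assume "B \<in> ?\<C>"
    then obtain \<alpha> \<beta> where \<alpha>\<beta>: "\<alpha> \<in> ?M" "\<beta> \<in> ?M" "\<phi> \<alpha>" "\<not> \<phi> \<beta>" and B: "B = C \<alpha> \<beta>" by auto
    have omega_cont: "continuous_map (topo Y) two_top (\<lambda>y. omega (\<gamma> y))" if "\<gamma> \<in> ?M" for \<gamma>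
    proof -
      have "continuous_map (topo Y) two_top (\<lambda>y\<in>pts Y. omega (\<gamma> y))"
        using compose_omega_u_mor[OF that] by (simp add: ord_mor_def)
      then show ?thesis by (rule continuous_map_eq) simp
    qed
    have "continuous_map (topo Y) two_top (\<lambda>y. omega (\<alpha> y) \<and> \<not> omega (\<beta> y))"
      by (intro continuous_map_two_top_conj continuous_map_two_top_Not omega_cont \<alpha>\<beta>)
    from clopen_preimage_two_top(2)[OF this] have "closedin (topo Y) B" by (simp add: B C_def)
    \<comment> \<open>an empty \<open>C \<alpha> \<beta>\<close> would mean \<open>\<alpha> \<le> \<beta>\<close>, against \<open>\<phi> \<alpha> = 1\<close> and \<open>\<phi> \<beta> = 0\<close>\<close>
    moreover have "B \<noteq> {}"
    proof
      assume "B = {}"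
      then have "join (E_obj Y) \<alpha> \<beta> = \<beta>"
        by (intro u_mor_N_eqI[OF E_closed(3)[OF \<alpha>\<beta>(1,2)] \<alpha>\<beta>(2)])
          (auto simp: omega_ops B C_def)
      with \<phi>(1)[OF \<alpha>\<beta>(1,2)] \<alpha>\<beta>(3,4) show False by simp
    qed
    ultimately show "closedin (topo Y) B \<and> B \<noteq> {}" ..
  next
    fix B B' assume "B \<in> ?\<C>" "B' \<in> ?\<C>"
    then obtain \<alpha> \<beta> \<alpha>' \<beta>' where \<alpha>\<beta>: "\<alpha> \<in> ?M" "\<beta> \<in> ?M" "\<phi> \<alpha>" "\<not> \<phi> \<beta>" and B: "B = C \<alpha> \<beta>"
      and \<alpha>\<beta>': "\<alpha>' \<in> ?M" "\<beta>' \<in> ?M" "\<phi> \<alpha>'" "\<not> \<phi> \<beta>'" and B': "B' = C \<alpha>' \<beta>'" by auto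
    have "C (meet (E_obj Y) \<alpha> \<alpha>') (join (E_obj Y) \<beta> \<beta>') \<in> ?\<C>"
      by (rule in_C) (use \<alpha>\<beta> \<alpha>\<beta>' E_closed(3,4) \<phi> in simp_all)
    moreover have "C (meet (E_obj Y) \<alpha> \<alpha>') (join (E_obj Y) \<beta> \<beta>') \<subseteq> B \<inter> B'"
      by (auto simp: B B' C_def omega_ops)
    ultimately show "\<exists>V\<in>?\<C>. V \<subseteq> B \<inter> B'" by (rule bexI[rotated])
  qed
  then have "\<exists>y. y \<in> \<Inter>?\<C>" by (simp only: ex_in_conv) simp
  then obtain y where y: "y \<in> \<Inter>?\<C>" by (rule exE)
  have yC: "y \<in> C \<alpha> \<beta>" if "\<alpha> \<in> ?M" "\<beta> \<in> ?M" "\<phi> \<alpha>" "\<not> \<phi> \<beta>" for \<alpha> \<beta>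
    by (rule InterD[OF y in_C[OF that]])
  have y_pts: "y \<in> pts Y"
    using yC[OF E_closed(2,1) \<phi>_bounds(2,1)] by (simp add: C_def)
  have "x = eval_str Y y"
  proof (rule E.ock_hom_N_eqI[OF x eval_str_hom[OF y_pts]])
    fix \<alpha> assume "\<alpha> \<in> carrier (E_obj Y)"
    then have \<alpha>: "\<alpha> \<in> ?M" by (simp add: E_obj_simps(1))
    \<comment> \<open>pair \<open>\<alpha>\<close> with \<open>0\<close> if \<open>\<phi> \<alpha> = 1\<close>, and \<open>1\<close> with \<open>\<alpha>\<close> otherwise\<close>
    have "\<phi> \<alpha> = omega (\<alpha> y)"
      using yC[OF \<alpha> E_closed(1) _ \<phi>_bounds(1)] yC[OF E_closed(2) \<alpha> \<phi>_bounds(2)]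
      by (auto simp: C_def)
    then show "omega (x \<alpha>) = omega (eval_str Y y \<alpha>)"
      by (simp add: \<phi>_def eval_str_apply[OF y_pts] \<alpha>)
  qed
  with y_pts show ?thesis by blast
qed

lemma eval_str_reflects:
  assumes "x \<in> pts Y" "y \<in> pts Y" "leq (D_obj (E_obj Y)) (eval_str Y x) (eval_str Y y)"
  shows "leq Y x y"
proof (rule ccontr)
  assume "\<not> leq Y x y"
  then obtain \<psi> where \<psi>: "\<psi> \<in> ord_mor Y two_space" "\<psi> x" "\<not> \<psi> y"
    using separation assms(1,2) by meson
  have "leq N_str (lift_str Y \<psi> x) (lift_str Y \<psi> y)"
    using assms lift_str_mor[OF \<psi>(1)] by (simp add: D_obj_simps(3) E_obj_simps(1) eval_str_apply)
  then have "omega (lift_str Y \<psi> x) \<longrightarrow> omega (lift_str Y \<psi> y)"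
    using omega_mor(2) by (simp add: ord_mor_def)
  with \<psi>(2,3) assms(1,2) show False by (simp add: omega_lift_str)
qed

lemma eval_str_iso: "u_iso Y (D_obj (E_obj Y)) (eval_str Y)"
proof -
  interpret E: ockham_algebra "E_obj Y" by unfold_locales (rule double_Ockham_E)
  let ?D = "D_obj (E_obj Y)"
  have "continuous_map (topo Y) (topo N_str) \<alpha>" if "\<alpha> \<in> u_mor Y N_str" for \<alpha>
    using that by (simp add: u_mor_def ord_mor_def)
  then have "continuous_map (topo Y) (product_topology (\<lambda>_. topo N_str) (carrier (E_obj Y)))
      (\<lambda>y. \<lambda>\<alpha>\<in>u_mor Y N_str. \<alpha> y)"
    by (simp add: continuous_map_power_iff E_obj_simps(1) del: N_str_simps)
  then have "continuous_map (topo Y) (product_topology (\<lambda>_. topo N_str) (carrier (E_obj Y))) (eval_str Y)"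
    by (rule continuous_map_eq) (simp add: eval_str_apply)
  then have cont: "continuous_map (topo Y) (topo ?D) (eval_str Y)"
    unfolding D_obj_simps(1) by (rule continuous_map_into_subtopology) (use eval_str_hom in auto)
  have "leq ?D (eval_str Y x) (eval_str Y y)" if "x \<in> pts Y" "y \<in> pts Y" "leq Y x y" for x y
    using that by (simp add: D_obj_simps(3) E_obj_simps(1) eval_str_apply u_mor_def ord_mor_def)
  with cont have mor: "eval_str Y \<in> ord_mor Y ?D"
    using eval_str_hom by (simp add: ord_mor_def D_obj_simps(2) PiE_iff) (simp add: eval_str_def)
  have "eval_str Y (uop Y l y) = uop ?D l (eval_str Y y)" if "y \<in> pts Y" for l y
    using that by (simp add: D_obj_simps(4) E_obj_simps(1) eval_str_apply u_mor_iff
        del: N_str_simps cong: restrict_cong)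
  with mor have umor: "eval_str Y \<in> u_mor Y ?D" by (simp add: u_mor_iff)
  have "ord_iso Y ?D (eval_str Y)"
  proof (rule ord_isoI_compact[OF compact _ mor])
    show "Hausdorff_space (topo ?D)"
      unfolding D_obj_simps(1) by (intro Hausdorff_space_subtopology compact_Hausdorff_power)
    show "eval_str Y ` pts Y = pts ?D"
      unfolding D_obj_simps(2) using eval_str_hom eval_str_surj by auto
    show "inj_on (eval_str Y) (pts Y)"
    proof (rule inj_onI)
      fix x y assume xy: "x \<in> pts Y" "y \<in> pts Y" "eval_str Y x = eval_str Y y"
      have "leq ?D (eval_str Y y) (eval_str Y y)" by (simp add: D_obj_simps(3) leq_N_refl)
      with xy show "x = y" using leq_antisym eval_str_reflects by simp
    qed
  qed (use eval_str_reflects in auto)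
  then show ?thesis by (rule u_isoI[OF _ umor u_closed])
qed

end

section \<open>Injectivity of the alter ego\<close>

text \<open>By unique lifting it suffices to extend \<open>\<omega> \<circ> \<alpha>\<close>. It divides the image of \<open>Y\<close> into two closed sets of
  \<open>Z\<close>, and no point of the first lies below a point of the second, because \<open>h\<close> reflects the order. A
  clopen up-set of \<open>Z\<close> between them is the required extension.\<close>

lemma u_mor_extends:
  assumes "ockham_space Y" "ockham_space Z" and emb: "u_embedding Y Z h" and \<alpha>: "\<alpha> \<in> u_mor Y N_str"
  shows "\<exists>\<beta>\<in>u_mor Z N_str. compose (pts Y) \<beta> h = \<alpha>"
proof -
  interpret Y: ockham_space Y by fact
  interpret Z: ockham_space Z by fact
  let ?S = "h ` pts Y"
  have S: "closedin (topo Z) ?S" and iso: "u_iso Y (on_subset Z ?S) h"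
    using emb by (simp_all add: u_embedding_def closed_substructure_def)
  have S_pts: "?S \<subseteq> pts Z" by (rule closedin_subset[OF S])
  obtain k where hQ: "h \<in> u_mor Y (on_subset Z ?S)" and k: "k \<in> u_mor (on_subset Z ?S) Y"
    and kh: "\<And>y. y \<in> pts Y \<Longrightarrow> k (h y) = y"
    using iso unfolding u_iso_def by auto
  have h: "h \<in> u_mor Y Z"
    using hQ by (auto simp: u_mor_iff ord_mor_def continuous_map_in_subtopology PiE_iff)
  have reflect: "leq Y y y'" if "y \<in> pts Y" "y' \<in> pts Y" "leq Z (h y) (h y')" for y y'
  proof -
    have "h y \<in> pts (on_subset Z ?S)" "h y' \<in> pts (on_subset Z ?S)"
      using S_pts that by auto
    then have "leq Y (k (h y)) (k (h y'))"
      using k that(3) by (simp add: u_mor_def ord_mor_def)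
    then show ?thesis using kh that by simp
  qed
  have \<psi>: "(\<lambda>y\<in>pts Y. omega (\<alpha> y)) \<in> ord_mor Y two_space"
    by (rule Y.compose_omega_u_mor[OF \<alpha>])
  have "continuous_map (subtopology (topo Z) ?S) two_top ((\<lambda>y\<in>pts Y. omega (\<alpha> y)) \<circ> k)"
    by (rule continuous_map_compose[of _ "topo Y"]) (use k \<psi> in \<open>simp_all add: u_mor_def ord_mor_def\<close>)
  note clopen = clopen_preimage_two_top(2,3)[OF this]
  have pts_S: "topspace (subtopology (topo Z) ?S) = ?S" using S_pts by auto
  have "{v \<in> ?S. ((\<lambda>y\<in>pts Y. omega (\<alpha> y)) \<circ> k) v} = h ` {y \<in> pts Y. omega (\<alpha> y)}"
    "{v \<in> ?S. \<not> ((\<lambda>y\<in>pts Y. omega (\<alpha> y)) \<circ> k) v} = h ` {y \<in> pts Y. \<not> omega (\<alpha> y)}"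
    using kh by auto
  with clopen have "closedin (subtopology (topo Z) ?S) (h ` {y \<in> pts Y. omega (\<alpha> y)})"
    "closedin (subtopology (topo Z) ?S) (h ` {y \<in> pts Y. \<not> omega (\<alpha> y)})"
    unfolding pts_S by simp_all
  then have closed: "closedin (topo Z) (h ` {y \<in> pts Y. omega (\<alpha> y)})"
    "closedin (topo Z) (h ` {y \<in> pts Y. \<not> omega (\<alpha> y)})"
    using S closedin_trans_full by blast+
  \<comment> \<open>the clopen up-sets of \<open>Z\<close>\<close>
  define \<W> where "\<W> = {W. openin (topo Z) W \<and> closedin (topo Z) W \<and>
      (\<forall>z\<in>W. \<forall>z'\<in>pts Z. leq Z z z' \<longrightarrow> z' \<in> W)}"
  have "\<exists>W\<in>\<W>. h ` {y \<in> pts Y. omega (\<alpha> y)} \<subseteq> W \<and> W \<inter> h ` {y \<in> pts Y. \<not> omega (\<alpha> y)} = {}"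
  proof (rule ring_of_clopens_separates_closed_sets[OF Z.compact _ _ _ _ closed])
    show "{} \<in> \<W>" "pts Z \<in> \<W>" by (simp_all add: \<W>_def)
    show "openin (topo Z) W \<and> closedin (topo Z) W" if "W \<in> \<W>" for W
      using that by (simp add: \<W>_def)
    show "V \<inter> W \<in> \<W> \<and> V \<union> W \<in> \<W>" if "V \<in> \<W>" "W \<in> \<W>" for V W
      using that unfolding \<W>_def by (simp add: openin_Int closedin_Int openin_Un closedin_Un) blast
    fix v w assume "v \<in> h ` {y \<in> pts Y. omega (\<alpha> y)}" "w \<in> h ` {y \<in> pts Y. \<not> omega (\<alpha> y)}"
    then obtain y y' where y: "y \<in> pts Y" "omega (\<alpha> y)" "v = h y"
      and y': "y' \<in> pts Y" "\<not> omega (\<alpha> y')" "w = h y'" by auto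
    have "\<not> leq Y y y'" using \<psi> y y' by (auto simp: ord_mor_def)
    then have "\<not> leq Z v w" using reflect y y' by auto
    moreover have vw: "v \<in> pts Z" "w \<in> pts Z" using S_pts y y' by auto
    ultimately obtain \<psi>' where \<psi>': "\<psi>' \<in> ord_mor Z two_space" "\<psi>' v" "\<not> \<psi>' w"
      using Z.separation by meson
    have "continuous_map (topo Z) two_top \<psi>'" using \<psi>'(1) by (simp add: ord_mor_def)
    then have "{z \<in> pts Z. \<psi>' z} \<in> \<W>"
      using \<psi>'(1) unfolding \<W>_def by (simp add: clopen_preimage_two_top ord_mor_def) blast
    then show "\<exists>W\<in>\<W>. v \<in> W \<and> w \<notin> W"
      using \<psi>' vw by (intro bexI[of _ "{z \<in> pts Z. \<psi>' z}"]) auto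
  qed
  then obtain W where W: "W \<in> \<W>" and hW: "h ` {y \<in> pts Y. omega (\<alpha> y)} \<subseteq> W"
    "W \<inter> h ` {y \<in> pts Y. \<not> omega (\<alpha> y)} = {}" by auto
  have W_pts: "W \<subseteq> pts Z" using W closedin_subset by (auto simp: \<W>_def)
  have hW_iff: "h y \<in> W \<longleftrightarrow> omega (\<alpha> y)" if "y \<in> pts Y" for y
    using hW that by auto
  have "openin (topo Z) (pts Z - W)" using W by (simp add: \<W>_def openin_diff)
  moreover have "{z \<in> pts Z. z \<in> W} = W" "{z \<in> pts Z. z \<notin> W} = pts Z - W" using W_pts by auto
  ultimately have "continuous_map (topo Z) two_top (\<lambda>z. z \<in> W)"
    using W by (simp add: continuous_map_two_top_iff \<W>_def)
  then have "continuous_map (topo Z) two_top (\<lambda>z\<in>pts Z. z \<in> W)"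
    by (rule continuous_map_eq) simp
  then have \<psi>W: "(\<lambda>z\<in>pts Z. z \<in> W) \<in> ord_mor Z two_space"
    using W by (simp add: ord_mor_def \<W>_def)
  let ?\<beta> = "lift_str Z (\<lambda>z\<in>pts Z. z \<in> W)"
  have \<beta>: "?\<beta> \<in> u_mor Z N_str" by (rule Z.lift_str_mor[OF \<psi>W])
  have "compose (pts Y) ?\<beta> h = \<alpha>"
  proof (rule Y.u_mor_N_eqI[OF u_mor_compose[OF h \<beta> Y.u_closed] \<alpha>])
    fix y assume y: "y \<in> pts Y"
    then have "h y \<in> pts Z" using S_pts by auto
    then show "omega (compose (pts Y) ?\<beta> h y) = omega (\<alpha> y)"
      using y hW_iff by (simp add: compose_def Z.omega_lift_str)
  qed
  with \<beta> show ?thesis by blast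
qed

section \<open>The duality\<close>

theorem theorem5p6:
  shows
    "omega \<in> lat_hom (lat_flat N_alg) two_lat \<inter> ord_mor (ord_flat N_str) two_space \<and>
     (\<forall>A :: 'a ockham2. double_Ockham A \<longrightarrow> in_Y TYPE('a) (D_obj A)) \<and>
     (\<forall>(A :: 'a ockham2) (B :: 'b ockham2). \<forall>h\<in>ock_hom A B.
        double_Ockham A \<longrightarrow> double_Ockham B \<longrightarrow> D_mor A B h \<in> u_mor (D_obj B) (D_obj A)) \<and>
     (\<forall>Y :: 'y uspace. in_Y TYPE('i) Y \<longrightarrow> double_Ockham (E_obj Y)) \<and>
     (\<forall>(Y :: 'y uspace) (Z :: 'z uspace). \<forall>h\<in>u_mor Y Z.
        in_Y TYPE('i) Y \<longrightarrow> in_Y TYPE('j) Z \<longrightarrow> E_mor Y Z h \<in> ock_hom (E_obj Z) (E_obj Y)) \<and>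
     strongly_dualises TYPE('a) TYPE('i) TYPE('y) TYPE('j) TYPE('z) \<and>
     (\<forall>A :: 'a ockham2. double_Ockham A \<longrightarrow>
        in_P TYPE('a) (ord_flat (D_obj A)) \<and> in_P TYPE('a) (H_obj (lat_flat A)) \<and>
        ord_iso (ord_flat (D_obj A)) (H_obj (lat_flat A)) (Phi A)) \<and>
     (\<forall>Y :: 'y uspace. in_Y TYPE('i) Y \<longrightarrow>
        in_P TYPE('i \<times> word) (ord_flat Y) \<and>
        bounded_distributive_lattice (lat_flat (E_obj Y)) \<and>
        bounded_distributive_lattice (K_obj (ord_flat Y)) \<and>
        lat_iso (lat_flat (E_obj Y)) (K_obj (ord_flat Y)) (Psi Y))"
proof (intro conjI allI ballI impI)
  show "omega \<in> lat_hom (lat_flat N_alg) two_lat \<inter> ord_mor (ord_flat N_str) two_space"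
    using omega_mor by simp
next
  fix A :: "'a ockham2" and B :: "'b ockham2" and h
  assume "h \<in> ock_hom A B" "double_Ockham A" "double_Ockham B"
  then show "D_mor A B h \<in> u_mor (D_obj B) (D_obj A)" by (intro D_mor_u_mor)
next
  fix Y :: "'y uspace" and Z :: "'z uspace" and h
  assume h: "h \<in> u_mor Y Z" and Y: "in_Y TYPE('i) Y" and Z: "in_Y TYPE('j) Z"
  show "E_mor Y Z h \<in> ock_hom (E_obj Z) (E_obj Y)"
    using h Y in_Y_ockham_space[OF Z] by (intro E_mor_ock_hom) (simp_all add: in_Y_def)
next
  show "strongly_dualises TYPE('a) TYPE('i) TYPE('y) TYPE('j) TYPE('z)"
    unfolding strongly_dualises_def fully_dualises_def dualises_def N_str_injective_def
  proof (intro conjI allI impI)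
    show "ock_iso A (E_obj (D_obj A)) (eval_alg A)" if "double_Ockham A" for A :: "'a ockham2"
      using that by (intro ockham_algebra.eval_alg_iso ockham_algebra.intro)
    show "u_iso Y (D_obj (E_obj Y)) (eval_str Y)" if "in_Y TYPE('i) Y" for Y :: "'y uspace"
      using in_Y_ockham_space[OF that] by (rule ockham_space.eval_str_iso)
    fix Y :: "'y uspace" and Z :: "'z uspace" and h \<alpha>
    assume "in_Y TYPE('i) Y \<and> in_Y TYPE('j) Z \<and> u_embedding Y Z h \<and> \<alpha> \<in> u_mor Y N_str"
    then show "\<exists>\<beta>\<in>u_mor Z N_str. compose (pts Y) \<beta> h = \<alpha>"
      by (intro u_mor_extends) (auto intro: in_Y_ockham_space)
  qed
next
  fix A :: "'a ockham2"
  assume "double_Ockham A"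
  then interpret ockham_algebra A by unfold_locales
  show "in_Y TYPE('a) (D_obj A)" by (rule in_Y_D)
  show "in_P TYPE('a) (ord_flat (D_obj A))" "in_P TYPE('a) (H_obj (lat_flat A))"
    by (rule in_P_D_H)+
  show "ord_iso (ord_flat (D_obj A)) (H_obj (lat_flat A)) (Phi A)"
    using ord_iso_Phi by (simp add: ord_iso_def ord_mor_def)
next
  fix Y :: "'y uspace"
  assume Y: "in_Y TYPE('i) Y"
  then interpret ockham_space Y by (rule in_Y_ockham_space)
  show "double_Ockham (E_obj Y)" by (rule double_Ockham_E)
  then show "bounded_distributive_lattice (lat_flat (E_obj Y))" by (simp add: double_Ockham_def)
  show "in_P TYPE('i \<times> word) (ord_flat Y)" by (rule in_Y_in_P[OF Y])
  show "bounded_distributive_lattice (K_obj (ord_flat Y))" by (rule bdl_K)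
  show "lat_iso (lat_flat (E_obj Y)) (K_obj (ord_flat Y)) (Psi Y)" by (rule lat_iso_Psi)
qed

end
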